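(* Let $X$ be a smooth Radon plane, and let $I$ be a nonempty set. Suppose that $X$ is not isometrically isomorphic to $\ell_2^2$. Then $X \oplus_\infty c_0(I) =_{BJ}\ell_2^2 \oplus_\infty c_0(I)$, and $X \oplus_\infty c_0(I)$ is not isometrically isomorphic to $\ell_2^2 \oplus_\infty c_0(I)$.
   Context: All Banach spaces are real. For elements $x,y$ of a Banach space, $x\perp_{BJ}y$ (Birkhoff-James orthogonality) means $\|x+\lambda y\|\geq\|x\|$ for each $\lambda\in\mathbb{R}$. A map $T:X\to Y$ between Banach spaces is a Birkhoff-James orthogonality preserver if it is a (possibly nonlinear) bijection and, for all $x,y\in X$, $x\perp_{BJ}y$ if and only if $Tx\perp_{BJ}Ty$. A map $T$ is norm-preserving if $\|Tx\|=\|x\|$ for each $x\in X$, homogeneous if $T(cx)=cTx$ for each $x\in X$, $c\in\mathbb{R}$, and bicontinuous if $T$ and $T^{-1}$ are both continuous. One writes $X=_{BJ}Y$ if there exists a norm-preserving homogeneous bicontinuous Birkhoff-James orthogonality preserver $T:X\to Y$. A Banach space $X$ is smooth if for each nonzero $x\in X$ the set $\{f\in B_{X^*}: f(x)=\|x\|\}$ is a singleton. A Radon plane is a two-dimensional real Banach space in which Birkhoff-James orthogonality is symmetric, i.e. $x\perp_{BJ}y$ implies $y\perp_{BJ}x$. $\ell_2^2$ is the two-dimensional Euclidean space. $c_0(I)$ is the Banach space (with the supremum norm) of all real systems $(a_n)_{n\in I}$ such that $\{n\in I:|a_n|\geq\varepsilon\}$ is finite for each $\varepsilon>0$. $X\oplus_\infty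 Y$ is $X\times Y$ with the norm $\|(x,y)\|_\infty=\max\{\|x\|,\|y\|\}$. Isometrically isomorphic means that there is a linear surjective isometry between the spaces. *)

theory Defs
  imports "HOL-Analysis.Analysis"
begin

section \<open>The maximum-norm direct sum\<close>

text \<open>The library norm on the product type is the Euclidean combination of the two norms, so the
  maximum-norm sum needs a type of its own.\<close>

typedef ('a, 'b) max_sum (infixr "\<oplus>\<^sub>\<infinity>" 20) = "UNIV :: ('a \<times> 'b) set"
  morphisms pair_of of_pair
  by simp

setup_lifting type_definition_max_sum

instantiation max_sum :: (real_vector, real_vector) real_vector
begin

lift_definition zero_max_sum :: "'a \<oplus>\<^sub>\<infinity> 'b" is 0 .
lift_definition plus_max_sum :: "('a \<oplus>\<^sub>\<infinity> 'b) \<Rightarrow> ('a \<oplus>\<^sub>\<infinity> 'b) \<Rightarrow> ('a \<oplus>\<^sub>\<infinity> 'b)" is "(+)" .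
lift_definition minus_max_sum :: "('a \<oplus>\<^sub>\<infinity> 'b) \<Rightarrow> ('a \<oplus>\<^sub>\<infinity> 'b) \<Rightarrow> ('a \<oplus>\<^sub>\<infinity> 'b)" is "(-)" .
lift_definition uminus_max_sum :: "('a \<oplus>\<^sub>\<infinity> 'b) \<Rightarrow> ('a \<oplus>\<^sub>\<infinity> 'b)" is uminus .
lift_definition scaleR_max_sum :: "real \<Rightarrow> ('a \<oplus>\<^sub>\<infinity> 'b) \<Rightarrow> ('a \<oplus>\<^sub>\<infinity> 'b)" is scaleR .

instance
  by standard (transfer; simp add: algebra_simps)+

end

instantiation max_sum :: (real_normed_vector, real_normed_vector) real_normed_vector
begin

lift_definition norm_max_sum :: "('a \<oplus>\<^sub>\<infinity> 'b) \<Rightarrow> real" is "\<lambda>(x, y). max (norm x) (norm y)" .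

definition sgn_max_sum :: "('a \<oplus>\<^sub>\<infinity> 'b) \<Rightarrow> ('a \<oplus>\<^sub>\<infinity> 'b)"
  where "sgn_max_sum u = u /\<^sub>R norm u"

definition dist_max_sum :: "('a \<oplus>\<^sub>\<infinity> 'b) \<Rightarrow> ('a \<oplus>\<^sub>\<infinity> 'b) \<Rightarrow> real"
  where "dist_max_sum u v = norm (u - v)"

definition uniformity_max_sum :: "(('a \<oplus>\<^sub>\<infinity> 'b) \<times> ('a \<oplus>\<^sub>\<infinity> 'b)) filter"
  where "uniformity_max_sum = (INF e\<in>{0<..}. principal {(u, v). dist u v < e})"

definition open_max_sum :: "('a \<oplus>\<^sub>\<infinity> 'b) set \<Rightarrow> bool"
  where "open_max_sum U \<longleftrightarrow> (\<forall>u\<in>U. \<forall>\<^sub>F (u', v) in uniformity. u' = u \<longrightarrow> v \<in> U)"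

instance
proof
  fix u v :: "'a \<oplus>\<^sub>\<infinity> 'b" and r :: real
  show "norm u = 0 \<longleftrightarrow> u = 0"
  proof (transfer, clarsimp simp: zero_prod_def)
    fix x :: 'a and y :: 'b
    show "max (norm x) (norm y) = 0 \<longleftrightarrow> x = 0 \<and> y = 0"
      using norm_ge_zero[of x] norm_ge_zero[of y]
      by (metis max.absorb1 max.cobounded1 max.cobounded2 norm_eq_zero norm_le_zero_iff)
  qed
  show "norm (u + v) \<le> norm u + norm v"
    by transfer (auto intro!: order_trans[OF norm_triangle_ineq add_mono])
  show "norm (r *\<^sub>R u) = \<bar>r\<bar> * norm u"
    by transfer (auto simp: max_mult_distrib_left)
qed (simp_all only: sgn_max_sum_def dist_max_sum_def uniformity_max_sum_def open_max_sum_def)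

end

lemma norm_of_pair: "norm (of_pair (x, y)) = max (norm x) (norm y)"
  by transfer simp

instance max_sum :: (banach, banach) banach
proof
  fix X :: "nat \<Rightarrow> 'a \<oplus>\<^sub>\<infinity> 'b"
  assume X: "Cauchy X"
  have le: "norm (fst (pair_of u)) \<le> norm u" "norm (snd (pair_of u)) \<le> norm u"
    for u :: "'a \<oplus>\<^sub>\<infinity> 'b"
    by (transfer, auto)+
  have diff: "pair_of (u - v) = pair_of u - pair_of v" for u v :: "'a \<oplus>\<^sub>\<infinity> 'b"
    by transfer simp
  have "Cauchy (\<lambda>n. fst (pair_of (X n)))" "Cauchy (\<lambda>n. snd (pair_of (X n)))"
    using X le[of "X m - X n" for m n] unfolding Cauchy_def dist_norm diff fst_diff snd_diff
    by (meson le_less_trans)+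
  then obtain x y where x: "(\<lambda>n. fst (pair_of (X n))) \<longlonglongrightarrow> x" and y: "(\<lambda>n. snd (pair_of (X n))) \<longlonglongrightarrow> y"
    by (meson Cauchy_convergent convergentD)
  have bound: "norm (u - of_pair (x, y)) \<le> norm (fst (pair_of u) - x) + norm (snd (pair_of u) - y)"
    for u :: "'a \<oplus>\<^sub>\<infinity> 'b"
    by transfer auto
  have "(\<lambda>n. norm (fst (pair_of (X n)) - x) + norm (snd (pair_of (X n)) - y)) \<longlonglongrightarrow> 0"
    using tendsto_add[OF tendsto_norm_zero[OF LIM_zero[OF x]] tendsto_norm_zero[OF LIM_zero[OF y]]]
    by simp
  then have "(\<lambda>n. X n - of_pair (x, y)) \<longlonglongrightarrow> 0"
    by (rule Lim_null_comparison[OF always_eventually[OF allI[OF bound]]])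
  then have "X \<longlonglongrightarrow> of_pair (x, y)"
    by (rule LIM_zero_cancel)
  then show "convergent X"
    by (rule convergentI)
qed


section \<open>The space of null systems\<close>

text \<open>The index set is the universe of the type \<open>'i\<close>; types are nonempty, so \<open>'i\<close> ranges over
  arbitrary nonempty index sets.\<close>

definition null_system :: "('i \<Rightarrow> real) \<Rightarrow> bool"
  where "null_system a \<longleftrightarrow> (\<forall>\<epsilon>>0. finite {n. \<bar>a n\<bar> \<ge> \<epsilon>})"

typedef 'i c0 = "{a :: 'i \<Rightarrow> real. null_system a}"
  morphisms coord c0_of
  by (rule exI[of _ "\<lambda>_. 0"]) (simp add: null_system_def)

setup_lifting type_definition_c0

lemma null_system_zero: "null_system (\<lambda>_. 0)"
  by (simp add: null_system_def)

lemma null_system_add: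
  assumes "null_system a" "null_system b"
  shows "null_system (\<lambda>n. a n + b n)"
  unfolding null_system_def
proof (intro allI impI)
  fix \<epsilon> :: real assume "\<epsilon> > 0"
  then have "finite ({n. \<bar>a n\<bar> \<ge> \<epsilon> / 2} \<union> {n. \<bar>b n\<bar> \<ge> \<epsilon> / 2})"
    using assms unfolding null_system_def by (meson finite_UnI half_gt_zero)
  moreover have "{n. \<bar>a n + b n\<bar> \<ge> \<epsilon>} \<subseteq> {n. \<bar>a n\<bar> \<ge> \<epsilon> / 2} \<union> {n. \<bar>b n\<bar> \<ge> \<epsilon> / 2}"
    by auto
  ultimately show "finite {n. \<bar>a n + b n\<bar> \<ge> \<epsilon>}"
    by (rule rev_finite_subset)
qed

lemma null_system_scale:
  assumes "null_system a"
  shows "null_system (\<lambda>n. c * a n)"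
  unfolding null_system_def
proof (intro allI impI)
  fix \<epsilon> :: real assume "\<epsilon> > 0"
  show "finite {n. \<bar>c * a n\<bar> \<ge> \<epsilon>}"
  proof (cases "c = 0")
    case False
    then have "{n. \<bar>c * a n\<bar> \<ge> \<epsilon>} = {n. \<bar>a n\<bar> \<ge> \<epsilon> / \<bar>c\<bar>}"
      by (auto simp: abs_mult field_simps)
    then show ?thesis
      using assms False \<open>\<epsilon> > 0\<close> by (simp add: null_system_def)
  qed (use \<open>\<epsilon> > 0\<close> in simp)
qed

lemma null_system_uminus: "null_system a \<Longrightarrow> null_system (\<lambda>n. - a n)"
  by (simp add: null_system_def)

lemma null_system_diff: "null_system a \<Longrightarrow> null_system b \<Longrightarrow> null_system (\<lambda>n. a n - b n)"
  using null_system_add[of a "\<lambda>n. - b n"] null_system_uminus[of b] by simp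

lemma null_system_bdd:
  fixes a :: "'i \<Rightarrow> real"
  assumes "null_system a"
  shows "bdd_above (range (\<lambda>n. \<bar>a n\<bar>))"
proof -
  have "finite {n. \<bar>a n\<bar> \<ge> 1}"
    using assms by (simp add: null_system_def)
  then have "bdd_above ((\<lambda>n. \<bar>a n\<bar>) ` {n. \<bar>a n\<bar> \<ge> 1} \<union> {..1})"
    by simp
  then show ?thesis
    by (rule bdd_above_mono) auto
qed

instantiation c0 :: (type) real_vector
begin

lift_definition zero_c0 :: "'a c0" is "\<lambda>_. 0" by (rule null_system_zero)
lift_definition plus_c0 :: "'a c0 \<Rightarrow> 'a c0 \<Rightarrow> 'a c0" is "\<lambda>a b n. a n + b n"
  by (rule null_system_add)
lift_definition minus_c0 :: "'a c0 \<Rightarrow> 'a c0 \<Rightarrow> 'a c0" is "\<lambda>a b n. a n - b n"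
  by (rule null_system_diff)
lift_definition uminus_c0 :: "'a c0 \<Rightarrow> 'a c0" is "\<lambda>a n. - a n"
  by (rule null_system_uminus)
lift_definition scaleR_c0 :: "real \<Rightarrow> 'a c0 \<Rightarrow> 'a c0" is "\<lambda>c a n. c * a n"
  by (rule null_system_scale)

instance
  by standard (transfer; simp add: algebra_simps)+

end

instantiation c0 :: (type) real_normed_vector
begin

definition norm_c0 :: "'a c0 \<Rightarrow> real"
  where "norm_c0 a = (SUP n. \<bar>coord a n\<bar>)"

definition sgn_c0 :: "'a c0 \<Rightarrow> 'a c0"
  where "sgn_c0 a = a /\<^sub>R norm a"

definition dist_c0 :: "'a c0 \<Rightarrow> 'a c0 \<Rightarrow> real"
  where "dist_c0 a b = norm (a - b)"

definition uniformity_c0 :: "('a c0 \<times> 'a c0) filter"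
  where "uniformity_c0 = (INF e\<in>{0<..}. principal {(a, b). dist a b < e})"

definition open_c0 :: "'a c0 set \<Rightarrow> bool"
  where "open_c0 U \<longleftrightarrow> (\<forall>a\<in>U. \<forall>\<^sub>F (a', b) in uniformity. a' = a \<longrightarrow> b \<in> U)"

instance
proof
  fix a b :: "'a c0" and r :: real
  have bdd: "bdd_above (range (\<lambda>n. \<bar>coord c n\<bar>))" for c :: "'a c0"
    using coord[of c] by (intro null_system_bdd) simp
  have le: "\<bar>coord c n\<bar> \<le> norm c" for c :: "'a c0" and n
    unfolding norm_c0_def by (rule cSUP_upper[OF _ bdd]) simp
  have least: "norm c \<le> K" if "\<And>n. \<bar>coord c n\<bar> \<le> K" for c :: "'a c0" and K
    unfolding norm_c0_def by (rule cSUP_least) (use that in auto)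
  have scale_le: "norm (s *\<^sub>R c) \<le> \<bar>s\<bar> * norm c" for c :: "'a c0" and s
    by (rule least) (simp add: scaleR_c0.rep_eq abs_mult mult_left_mono le)
  show "norm a = 0 \<longleftrightarrow> a = 0"
  proof
    assume "norm a = 0"
    then have "coord a n = coord 0 n" for n
      using le[of a n] by (simp add: zero_c0.rep_eq)
    then show "a = 0"
      by (metis coord_inject ext)
  qed (simp add: norm_c0_def zero_c0.rep_eq)
  show "norm (a + b) \<le> norm a + norm b"
    by (rule least) (auto simp: plus_c0.rep_eq intro: order_trans[OF abs_triangle_ineq] add_mono le)
  show "norm (r *\<^sub>R a) = \<bar>r\<bar> * norm a"
  proof (cases "r = 0")
    case True
    then show ?thesis
      by (simp add: norm_c0_def zero_c0.rep_eq)
  next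
    case False
    then have "\<bar>r\<bar> * norm a \<le> norm (r *\<^sub>R a)"
      using scale_le[of "inverse r" "r *\<^sub>R a"] by (simp add: field_simps)
    then show ?thesis
      using scale_le[of r a] by simp
  qed
qed (simp_all only: sgn_c0_def dist_c0_def uniformity_c0_def open_c0_def)

end

lemma abs_coord_le_norm: "\<bar>coord a n\<bar> \<le> norm a"
  unfolding norm_c0_def
  by (rule cSUP_upper[OF _ null_system_bdd]) (use coord[of a] in auto)

lemma norm_c0_least: "(\<And>n. \<bar>coord a n\<bar> \<le> K) \<Longrightarrow> norm a \<le> K"
  unfolding norm_c0_def by (rule cSUP_least) auto

instance c0 :: (type) banach
proof
  fix X :: "nat \<Rightarrow> 'a c0"
  assume X: "Cauchy X"
  have dist_le: "\<bar>coord a n - coord b n\<bar> \<le> norm (a - b)" for a b :: "'a c0" and n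
    using abs_coord_le_norm[of "a - b" n] by (simp add: minus_c0.rep_eq)
  have "Cauchy (\<lambda>k. coord (X k) n)" for n
    using X dist_le unfolding Cauchy_def dist_norm real_norm_def by (meson le_less_trans)
  then have "\<exists>l. (\<lambda>k. coord (X k) n) \<longlonglongrightarrow> l" for n
    by (meson Cauchy_convergent convergentD)
  then obtain l where l: "(\<lambda>k. coord (X k) n) \<longlonglongrightarrow> l n" for n
    by metis
  have unif: "\<exists>M. \<forall>k\<ge>M. \<forall>n. \<bar>coord (X k) n - l n\<bar> \<le> e" if "e > 0" for e
  proof -
    obtain M where M: "\<And>k m. k \<ge> M \<Longrightarrow> m \<ge> M \<Longrightarrow> norm (X k - X m) < e"
      using X \<open>e > 0\<close> unfolding Cauchy_def dist_norm by metis
    have "\<bar>coord (X k) n - l n\<bar> \<le> e" if "k \<ge> M" for k n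
    proof (rule tendsto_upperbound)
      show "(\<lambda>m. \<bar>coord (X k) n - coord (X m) n\<bar>) \<longlonglongrightarrow> \<bar>coord (X k) n - l n\<bar>"
        by (intro tendsto_intros l)
      show "\<forall>\<^sub>F m in sequentially. \<bar>coord (X k) n - coord (X m) n\<bar> \<le> e"
        using M[OF that] dist_le
        by (intro eventually_sequentiallyI[of M]) (meson less_imp_le order_trans)
    qed simp
    then show ?thesis by blast
  qed
  have null: "null_system l"
    unfolding null_system_def
  proof (intro allI impI)
    fix e :: real assume "e > 0"
    then obtain M where M: "\<And>n. \<bar>coord (X M) n - l n\<bar> \<le> e / 2"
      using unif[of "e / 2"] by auto
    have "{n. \<bar>l n\<bar> \<ge> e} \<subseteq> {n. \<bar>coord (X M) n\<bar> \<ge> e / 2}"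
    proof
      fix n assume "n \<in> {n. \<bar>l n\<bar> \<ge> e}"
      then show "n \<in> {n. \<bar>coord (X M) n\<bar> \<ge> e / 2}"
        using M[of n] unfolding mem_Collect_eq by linarith
    qed
    moreover have "finite {n. \<bar>coord (X M) n\<bar> \<ge> e / 2}"
      using coord[of "X M"] half_gt_zero[OF \<open>e > 0\<close>] unfolding null_system_def mem_Collect_eq by blast
    ultimately show "finite {n. \<bar>l n\<bar> \<ge> e}"
      by (rule finite_subset)
  qed
  then have coord_l: "coord (c0_of l) = l"
    by (simp add: c0_of_inverse)
  have "X \<longlonglongrightarrow> c0_of l"
  proof (rule LIMSEQ_I)
    fix e :: real assume "e > 0"
    then obtain M where "\<And>k n. k \<ge> M \<Longrightarrow> \<bar>coord (X k) n - l n\<bar> \<le> e / 2"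
      using unif[of "e / 2"] by auto
    then have "norm (X k - c0_of l) \<le> e / 2" if "k \<ge> M" for k
      using that by (intro norm_c0_least) (simp add: minus_c0.rep_eq coord_l)
    then show "\<exists>M. \<forall>k\<ge>M. norm (X k - c0_of l) < e"
      using \<open>e > 0\<close> by (intro exI[of _ M]) force
  qed
  then show "convergent X"
    by (rule convergentI)
qed


section \<open>Birkhoff-James orthogonality\<close>

definition bj_orthogonal :: "'a::banach \<Rightarrow> 'a \<Rightarrow> bool" (infix "\<bottom>\<^sub>B\<^sub>J" 50)
  where "x \<bottom>\<^sub>B\<^sub>J y \<longleftrightarrow> (\<forall>r::real. norm (x + r *\<^sub>R y) \<ge> norm x)"

definition bj_preserver :: "('a::banach \<Rightarrow> 'b::banach) \<Rightarrow> bool"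
  where "bj_preserver T \<longleftrightarrow> bij T \<and> (\<forall>x y. x \<bottom>\<^sub>B\<^sub>J y \<longleftrightarrow> T x \<bottom>\<^sub>B\<^sub>J T y)"

definition norm_preserving :: "('a::banach \<Rightarrow> 'b::banach) \<Rightarrow> bool"
  where "norm_preserving T \<longleftrightarrow> (\<forall>x. norm (T x) = norm x)"

definition homogeneous_map :: "('a::banach \<Rightarrow> 'b::banach) \<Rightarrow> bool"
  where "homogeneous_map T \<longleftrightarrow> (\<forall>x (c::real). T (c *\<^sub>R x) = c *\<^sub>R T x)"

text \<open>Only used for bijections, so that \<open>inv T\<close> is the inverse map.\<close>

definition bicontinuous :: "('a::banach \<Rightarrow> 'b::banach) \<Rightarrow> bool"
  where "bicontinuous T \<longleftrightarrow> continuous_on UNIV T \<and> continuous_on UNIV (inv T)"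

definition bj_equivalent :: "'a::banach itself \<Rightarrow> 'b::banach itself \<Rightarrow> bool" (infix "=\<^sub>B\<^sub>J" 50)
  where "X =\<^sub>B\<^sub>J Y \<longleftrightarrow>
    (\<exists>T :: 'a \<Rightarrow> 'b. norm_preserving T \<and> homogeneous_map T \<and> bicontinuous T \<and> bj_preserver T)"

definition isometrically_isomorphic :: "'a::banach itself \<Rightarrow> 'b::banach itself \<Rightarrow> bool"
  where "isometrically_isomorphic X Y \<longleftrightarrow>
    (\<exists>T :: 'a \<Rightarrow> 'b. linear T \<and> surj T \<and> (\<forall>x. norm (T x) = norm x))"

definition smooth_space :: "'a::banach itself \<Rightarrow> bool"
  where "smooth_space X \<longleftrightarrow>
    (\<forall>x::'a. x \<noteq> 0 \<longrightarrow> is_singleton {f :: 'a \<Rightarrow>\<^sub>L real. norm f \<le> 1 \<and> blinfun_apply f x = norm x})"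

text \<open>In the library \<open>dim\<close> is \<open>0\<close> for infinite-dimensional spaces, so \<open>dim UNIV = 2\<close> includes
  finite-dimensionality.\<close>

definition radon_plane :: "'a::banach itself \<Rightarrow> bool"
  where "radon_plane X \<longleftrightarrow> dim (UNIV :: 'a set) = 2 \<and> (\<forall>x y :: 'a. x \<bottom>\<^sub>B\<^sub>J y \<longrightarrow> y \<bottom>\<^sub>B\<^sub>J x)"

end

theory Submission
  imports Defs
begin

text \<open>
  Identify \<open>X\<close> with \<open>\<complex>\<close> by a linear chart and let \<open>\<nabla>z\<close> be the gradient of the transported norm \<open>N\<close>
  at \<open>z\<close>; smoothness makes \<open>\<nabla>\<close> a continuous function. Birkhoff-James orthogonality \<open>z \<bottom> w\<close> means
  \<open>\<langle>\<nabla>z, w\<rangle> = 0\<close>, so the unit direction orthogonal to \<open>z\<close> is \<open>\<i> \<nabla>z\<close>, and symmetry of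
  orthogonality says that \<open>z \<mapsto> \<i> \<nabla>z\<close> acts on directions with square \<open>-1\<close>. The map sending \<open>z\<close> to the
  vector of Euclidean length \<open>N z\<close> on the bisector of \<open>z\<close> and \<open>\<nabla>z\<close> conjugates this action
  to multiplication by \<open>\<i>\<close>, because \<open>\<nabla>(\<i> \<nabla>z)\<close> has the direction of \<open>\<i> z\<close>. It therefore turns the sign
  of \<open>\<langle>\<nabla>z, w\<rangle>\<close> into the sign of the Euclidean inner product.

  That sign decides whether \<open>\<parallel>z + r w\<parallel> \<ge> \<parallel>z\<parallel>\<close> for all \<open>r \<ge> 0\<close>. In \<open>X \<oplus>\<^sub>\<infinity> c\<^sub>0(I)\<close> this one-sided
  orthogonality holds exactly if it holds in one of the norming components, so acting by the
  map above on \<open>X\<close> and by the identity on \<open>c\<^sub>0(I)\<close> preserves it, hence also orthogonality.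

  On the other hand, since \<open>X\<close> is strictly convex, every splitting of \<open>X \<oplus>\<^sub>\<infinity> c\<^sub>0(I)\<close> as a maximum-norm sum
  of a line and a hyperplane has \<open>X\<close> in the hyperplane. The coordinates of \<open>c\<^sub>0(I)\<close> in the target
  pull back to such splittings, so a linear isometry maps \<open>X\<close> into \<open>\<ell>\<^sub>2\<^sup>2\<close>.
\<close>

section \<open>One-sided orthogonality\<close>

text \<open>Only \<open>r \<ge> 0\<close> is tested because this version passes to maximum norms:
  different components may be responsible for the two signs of \<open>r\<close>, so Birkhoff-James
  orthogonality itself is not decided by a single component.\<close>

definition half_orthogonal :: "'a::real_normed_vector \<Rightarrow> 'a \<Rightarrow> bool"
  where "half_orthogonal x y \<longleftrightarrow> (\<forall>r\<ge>0. norm x \<le> norm (x + r *\<^sub>R y))"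

lemma half_orthogonal_zero [simp]: "half_orthogonal 0 y"
  by (simp add: half_orthogonal_def)

lemma bj_orthogonal_iff_half: "x \<bottom>\<^sub>B\<^sub>J y \<longleftrightarrow> half_orthogonal x y \<and> half_orthogonal x (- y)"
proof
  assume half: "half_orthogonal x y \<and> half_orthogonal x (- y)"
  show "x \<bottom>\<^sub>B\<^sub>J y"
    unfolding bj_orthogonal_def
  proof
    fix r :: real
    show "norm x \<le> norm (x + r *\<^sub>R y)"
    proof (cases "r \<ge> 0")
      case False
      then have "norm x \<le> norm (x + (- r) *\<^sub>R (- y))"
        using half unfolding half_orthogonal_def by (metis less_eq_real_def linorder_le_cases neg_0_le_iff_le)
      then show ?thesis by simp
    qed (use half in \<open>simp add: half_orthogonal_def\<close>)
  qed
next
  assume "x \<bottom>\<^sub>B\<^sub>J y"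
  then have "norm x \<le> norm (x + r *\<^sub>R y)" "norm x \<le> norm (x + r *\<^sub>R (- y))" for r
    unfolding bj_orthogonal_def by (metis, metis scaleR_minus_left scaleR_minus_right)
  then show "half_orthogonal x y \<and> half_orthogonal x (- y)"
    unfolding half_orthogonal_def by blast
qed

text \<open>A nonnegative inner product suffices by Cauchy-Schwarz for \<open>x\<close> and
  \<open>x + r *\<^sub>R y\<close>; a negative one is refuted at the minimiser of a
  quadratic.\<close>

lemma half_orthogonal_iff_inner:
  fixes x y :: "'a::real_inner"
  shows "half_orthogonal x y \<longleftrightarrow> 0 \<le> x \<bullet> y"
proof
  assume nonneg: "0 \<le> x \<bullet> y"
  show "half_orthogonal x y"
    unfolding half_orthogonal_def
  proof (intro allI impI)
    fix r :: real assume "0 \<le> r"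
    then have "x \<bullet> x \<le> x \<bullet> (x + r *\<^sub>R y)"
      using nonneg by (simp add: inner_add_right)
    also have "\<dots> \<le> norm x * norm (x + r *\<^sub>R y)"
      by (rule norm_cauchy_schwarz)
    finally show "norm x \<le> norm (x + r *\<^sub>R y)"
      by (cases "x = 0") (simp_all add: dot_square_norm power2_eq_square)
  qed
next
  assume half: "half_orthogonal x y"
  show "0 \<le> x \<bullet> y"
  proof (rule ccontr)
    assume neg: "\<not> 0 \<le> x \<bullet> y"
    then have "y \<bullet> y > 0" by auto
    \<comment> \<open>The minimiser of the quadratic
      \<open>r \<mapsto> (norm (x + r *\<^sub>R y))\<^sup>2\<close>.\<close>
    define r where "r = - (x \<bullet> y) / (y \<bullet> y)"
    have "r > 0"
      using neg \<open>y \<bullet> y > 0\<close> unfolding r_def by (intro divide_pos_pos) auto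
    have "(x + r *\<^sub>R y) \<bullet> (x + r *\<^sub>R y) = x \<bullet> x + r * (x \<bullet> y) + r * (x \<bullet> y + r * (y \<bullet> y))"
      by (simp add: inner_add_left inner_add_right inner_commute algebra_simps)
    also have "x \<bullet> y + r * (y \<bullet> y) = 0"
      using \<open>y \<bullet> y > 0\<close> by (simp add: r_def)
    finally have "(x + r *\<^sub>R y) \<bullet> (x + r *\<^sub>R y) < x \<bullet> x"
      using \<open>r > 0\<close> neg by (simp add: mult_pos_neg)
    then have "norm (x + r *\<^sub>R y) < norm x"
      by (simp add: norm_lt)
    then show False
      using half \<open>r > 0\<close> by (auto simp: half_orthogonal_def not_le[symmetric])
  qed
qed


section \<open>Plane geometry in complex coordinates\<close>

lemma inner_i_self [simp]: "z \<bullet> (\<i> * z) = 0" for z :: complex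
  by (simp add: inner_complex_def)

lemma inner_i_i [simp]: "(\<i> * z) \<bullet> (\<i> * w) = z \<bullet> w"
  by (simp add: inner_complex_def)

lemma sgn_i_mult [simp]: "sgn (\<i> * z) = \<i> * sgn z"
  by (simp add: sgn_eq norm_mult)

lemma sgn_inner_pos_iff: "0 < sgn x \<bullet> sgn y \<longleftrightarrow> 0 < x \<bullet> y" for x y :: complex
  by (cases "x = 0"; cases "y = 0") (simp_all add: sgn_div_norm zero_less_mult_iff)

text \<open>The Binet-Cauchy identity in the plane: \<open>z \<bullet> (\<i> * w)\<close> is, up to
  sign, the determinant of \<open>z\<close> and \<open>w\<close>.\<close>

lemma cross_identity: "(z \<bullet> (\<i> * w)) * (G \<bullet> (\<i> * H)) = (z \<bullet> G) * (w \<bullet> H) - (z \<bullet> H) * (w \<bullet> G)"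
  for z w G H :: complex
  by (simp add: inner_complex_def algebra_simps)

text \<open>Cramer's rule without denominators: \<open>p \<bullet> z\<close> is the determinant of
  \<open>z\<close> and \<open>\<i> * p\<close>. The typical choice of \<open>p\<close> is the
  gradient at \<open>z\<close>, whose rotation spans the directions orthogonal to
  \<open>z\<close>.\<close>

lemma expand_in_basis:
  fixes z p w :: complex
  shows "(p \<bullet> z) *\<^sub>R w = (p \<bullet> w) *\<^sub>R z + (w \<bullet> (\<i> * z)) *\<^sub>R (\<i> * p)"
  by (simp add: inner_complex_def complex_eq_iff algebra_simps)

lemma orthogonal_i_parallel:
  fixes z w :: complex
  assumes "w \<noteq> 0" "(\<i> * w) \<bullet> z = 0"
  obtains t where "z = t *\<^sub>R w"
proof
  have "(w \<bullet> w) *\<^sub>R z = (w \<bullet> z) *\<^sub>R w"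
    using expand_in_basis[of w w z] assms by (simp add: inner_commute)
  then have "(1 / (w \<bullet> w)) *\<^sub>R (w \<bullet> w) *\<^sub>R z = (1 / (w \<bullet> w)) *\<^sub>R (w \<bullet> z) *\<^sub>R w"
    by simp
  then show "z = (w \<bullet> z / (w \<bullet> w)) *\<^sub>R w"
    using assms by simp
qed

text \<open>Expanding \<open>w\<close> and \<open>q\<close> in the bases \<open>z\<close>,
  \<open>\<i> * p\<close> and \<open>p\<close>, \<open>\<i> * z\<close> reduces the claim to
  \<open>(A + C) * (1 + m) + (B - E) * s > 0\<close>. By the orientation hypothesis \<open>B\<close>
  and \<open>E\<close> do not have opposite signs, and their absolute values differ from
  \<open>m\<close> by at most \<open>A\<close> and \<open>C\<close>; hence
  \<open>\<bar>B - E\<bar> \<le> A + C\<close>, while \<open>\<bar>s\<bar> \<le> 1\<close>.\<close>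

lemma bisector_inner_pos:
  fixes z w p q :: complex
  assumes unit: "norm z = 1" "norm w = 1" "norm p = 1" "norm q = 1"
    and pos: "0 < p \<bullet> z" "0 < p \<bullet> w" "0 < q \<bullet> z"
    and orientation: "0 \<le> (z \<bullet> (\<i> * w)) * (p \<bullet> (\<i> * q))"
  shows "0 < (z + p) \<bullet> (w + q)"
proof -
  define m A B C E s where "m = p \<bullet> z" and "A = p \<bullet> w" and "B = w \<bullet> (\<i> * z)"
    and "C = z \<bullet> q" and "E = q \<bullet> (\<i> * p)" and "s = z \<bullet> (\<i> * p)"
  have w: "m *\<^sub>R w = A *\<^sub>R z + B *\<^sub>R (\<i> * p)"
    unfolding m_def A_def B_def by (rule expand_in_basis)
  have q: "m *\<^sub>R q = C *\<^sub>R p + E *\<^sub>R (\<i> * z)"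
    unfolding m_def C_def E_def inner_commute[of p z] by (rule expand_in_basis)
  have "m > 0" "A > 0" "C > 0"
    using pos by (simp_all add: m_def A_def C_def inner_commute)
  have unit': "z \<bullet> z = 1" "p \<bullet> p = 1"
    using unit by (simp_all add: dot_square_norm)
  have ps: "p \<bullet> (\<i> * z) = - s"
    by (simp add: s_def inner_complex_def)
  have product: "m * ((z + p) \<bullet> (w + q)) = (A + C) * (1 + m) + (B - E) * s"
  proof -
    have "m * ((z + p) \<bullet> (w + q)) = (z + p) \<bullet> (m *\<^sub>R w + m *\<^sub>R q)"
      by (simp add: scaleR_add_right[symmetric])
    also have "\<dots> = (z + p) \<bullet> (A *\<^sub>R z + B *\<^sub>R (\<i> * p) + (C *\<^sub>R p + E *\<^sub>R (\<i> * z)))"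
      by (simp only: w q)
    also have "\<dots> = (A + C) * (1 + m) + (B - E) * s"
      using unit' ps
      by (simp add: inner_add_left inner_add_right inner_commute[of z p] flip: m_def s_def)
        (simp add: algebra_simps)
    finally show ?thesis .
  qed
  \<comment> \<open>A triangle with sides of length \<open>m\<close>, \<open>\<bar>B\<bar>\<close>
    and \<open>A\<close>; below, likewise one with sides \<open>m\<close>,
    \<open>\<bar>E\<bar>\<close> and \<open>C\<close>.\<close>
  have "\<bar>norm (m *\<^sub>R w) - norm (B *\<^sub>R (\<i> * p))\<bar> \<le> norm (m *\<^sub>R w - B *\<^sub>R (\<i> * p))"
    by (rule norm_triangle_ineq3)
  moreover have "m *\<^sub>R w - B *\<^sub>R (\<i> * p) = A *\<^sub>R z"
    by (simp add: w)
  ultimately have 1: "\<bar>m - \<bar>B\<bar>\<bar> \<le> A"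
    using \<open>m > 0\<close> \<open>A > 0\<close> unit by (simp add: norm_mult)
  have "\<bar>norm (m *\<^sub>R q) - norm (E *\<^sub>R (\<i> * z))\<bar> \<le> norm (m *\<^sub>R q - E *\<^sub>R (\<i> * z))"
    by (rule norm_triangle_ineq3)
  moreover have "m *\<^sub>R q - E *\<^sub>R (\<i> * z) = C *\<^sub>R p"
    by (simp add: q)
  ultimately have 2: "\<bar>m - \<bar>E\<bar>\<bar> \<le> C"
    using \<open>m > 0\<close> \<open>C > 0\<close> unit by (simp add: norm_mult)
  have "0 \<le> B * E"
    using orientation by (simp add: B_def E_def inner_complex_def algebra_simps)
  then have "\<bar>B - E\<bar> \<le> A + C"
    using 1 2 by (auto simp: zero_le_mult_iff)
  moreover have "\<bar>s\<bar> \<le> 1"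
    using Cauchy_Schwarz_ineq2[of z "\<i> * p"] unit by (simp add: s_def norm_mult)
  ultimately have "\<bar>B - E\<bar> * \<bar>s\<bar> \<le> (A + C) * 1"
    using \<open>A > 0\<close> \<open>C > 0\<close> by (intro mult_mono) auto
  then have "- (A + C) \<le> (B - E) * s"
    by (simp add: abs_mult[symmetric] abs_le_iff)
  moreover have "(A + C) * m > 0"
    using \<open>m > 0\<close> \<open>A > 0\<close> \<open>C > 0\<close> by simp
  ultimately have "0 < (A + C) * (1 + m) + (B - E) * s"
    by (simp add: algebra_simps)
  then have "0 < m * ((z + p) \<bullet> (w + q))"
    using product by simp
  then show ?thesis
    using \<open>m > 0\<close> by (simp add: zero_less_mult_iff)
qed


lemma complex_isometry_plane:
  obtains g :: "complex \<Rightarrow> real^2" and h :: "real^2 \<Rightarrow> complex"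
  where "linear g" "linear h" "\<And>z. norm (g z) = norm z" "\<And>x. norm (h x) = norm x"
    "\<And>z. h (g z) = z" "\<And>x. g (h x) = x"
proof (rule isometries_subspaces[of "UNIV :: complex set" "UNIV :: (real^2) set"])
  fix g :: "complex \<Rightarrow> real^2" and h
  assume "linear g" "linear h" "\<And>z. z \<in> UNIV \<Longrightarrow> norm (g z) = norm z" "\<And>x. x \<in> UNIV \<Longrightarrow> norm (h x) = norm x"
    "\<And>z. z \<in> UNIV \<Longrightarrow> h (g z) = z" "\<And>x. x \<in> UNIV \<Longrightarrow> g (h x) = x"
  then show thesis
    using that[of g h] by simp
qed simp_all


section \<open>The bisector map of a smooth Radon plane\<close>

text \<open>Support functionals are encoded as vectors \<open>G\<close> acting by the inner product.
  The one-sided bound, taken at \<open>w\<close> and \<open>- w\<close>, says that the dual norm is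
  at most one.\<close>

locale smooth_radon_chart =
  fixes P :: "complex \<Rightarrow> 'x::banach"
  assumes linear_P: "linear P" and inj_P: "inj P"
    and smooth: "z \<noteq> 0 \<Longrightarrow> \<exists>!G. (\<forall>w. G \<bullet> w \<le> norm (P w)) \<and> G \<bullet> z = norm (P z)"
    and radon: "P z \<bottom>\<^sub>B\<^sub>J P w \<Longrightarrow> P w \<bottom>\<^sub>B\<^sub>J P z"
begin

section \<open>The transported norm and its support vectors\<close>

definition N :: "complex \<Rightarrow> real"
  where "N z = norm (P z)"

text \<open>At \<open>0\<close> the describing conditions hold for many \<open>G\<close>, so
  \<open>grad 0\<close> is unspecified.\<close>

definition grad :: "complex \<Rightarrow> complex"
  where "grad z = (THE G. (\<forall>w. G \<bullet> w \<le> N w) \<and> G \<bullet> z = N z)"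

lemma N_eq_0 [simp]: "N z = 0 \<longleftrightarrow> z = 0"
  using linear_injective_0[OF linear_P] inj_P linear_0[OF linear_P] by (auto simp: N_def)

lemma N_nonneg [simp]: "0 \<le> N z"
  by (simp add: N_def)

lemma N_pos: "z \<noteq> 0 \<Longrightarrow> 0 < N z"
  using N_eq_0[of z] N_nonneg[of z] by linarith

lemma N_scaleR [simp]: "N (r *\<^sub>R z) = \<bar>r\<bar> * N z"
  by (simp add: N_def linear_cmul[OF linear_P])

lemma N_zero [simp]: "N 0 = 0"
  by simp

lemma continuous_on_N: "continuous_on A N"
  unfolding N_def using linear_continuous_on[of P A] linear_P
  by (intro continuous_intros) (simp add: linear_conv_bounded_linear)

lemma N_orthogonal_iff: "P z \<bottom>\<^sub>B\<^sub>J P w \<longleftrightarrow> (\<forall>r. N z \<le> N (z + r *\<^sub>R w))"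
  by (simp add: bj_orthogonal_def N_def linear_add[OF linear_P] linear_cmul[OF linear_P])

lemma grad_unique:
  assumes "z \<noteq> 0" "\<And>w. G \<bullet> w \<le> N w" "G \<bullet> z = N z"
  shows "grad z = G"
  unfolding grad_def using assms smooth[OF assms(1)] by (intro the1_equality) (auto simp: N_def)

lemma grad_props: 
  assumes "z \<noteq> 0"
  shows "(\<forall>w. grad z \<bullet> w \<le> N w) \<and> grad z \<bullet> z = N z"
  unfolding grad_def using theI'[OF smooth[OF assms]] unfolding N_def .

lemma grad_le: "z \<noteq> 0 \<Longrightarrow> grad z \<bullet> w \<le> N w"
  and grad_self: "z \<noteq> 0 \<Longrightarrow> grad z \<bullet> z = N z"
  using grad_props by auto

lemma grad_nonzero: "z \<noteq> 0 \<Longrightarrow> grad z \<noteq> 0"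
  using grad_self[of z] N_eq_0[of z] by (metis inner_zero_left)

lemma grad_scaleR:
  assumes "z \<noteq> 0" "r \<noteq> 0"
  shows "grad (r *\<^sub>R z) = sgn r *\<^sub>R grad z"
proof (rule grad_unique)
  show "(sgn r *\<^sub>R grad z) \<bullet> w \<le> N w" for w
    using grad_le[OF assms(1), of "sgn r *\<^sub>R w"] assms(2) by (simp add: abs_sgn_eq)
  show "(sgn r *\<^sub>R grad z) \<bullet> (r *\<^sub>R z) = N (r *\<^sub>R z)"
    using grad_self[OF assms(1)] assms(2) by (simp add: abs_sgn mult.commute)
qed (use assms in simp)

text \<open>The support inequality is evaluated at \<open>grad z\<close> itself. The bound gives
  \<open>grad\<close> a compact target, as the closed graph criterion for continuity
  requires.\<close>

lemma grad_bounded: "\<exists>C. \<forall>z. z \<noteq> 0 \<longrightarrow> norm (grad z) \<le> C"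
proof -
  obtain C where C: "\<And>w. norm (P w) \<le> norm w * C"
    using linear_P bounded_linear.bounded by (auto simp: linear_conv_bounded_linear)
  have "norm (grad z) \<le> C" if "z \<noteq> 0" for z
  proof -
    have "norm (grad z) * norm (grad z) \<le> norm (grad z) * C"
      using grad_le[OF that, of "grad z"] C[of "grad z"]
      by (simp add: N_def power2_norm_eq_inner flip: power2_eq_square)
    then show ?thesis
      using grad_nonzero[OF that] by simp
  qed
  then show ?thesis by blast
qed

text \<open>The graph of \<^term>\<open>grad\<close> is closed because it is cut out by the supporting conditions.\<close>

lemma continuous_on_grad: "continuous_on (- {0}) grad"
proof -
  obtain C where C: "\<And>z. z \<noteq> 0 \<Longrightarrow> norm (grad z) \<le> C"
    using grad_bounded by blast
  let ?E = "{p. snd p \<bullet> fst p = N (fst p)} \<inter> (\<Inter>w. {p. snd p \<bullet> w \<le> N w})"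
  have "closed ?E"
    by (intro closed_Int closed_INT ballI closed_Collect_eq closed_Collect_le continuous_intros
        continuous_on_compose2[OF continuous_on_N[of UNIV]]) auto
  moreover have "(\<lambda>z. (z, grad z)) ` (- {0}) = (- {0}) \<times> cball 0 C \<inter> ?E"
    using C grad_props by (auto simp: image_iff) (metis grad_unique)
  ultimately have "closedin (top_of_set ((- {0}) \<times> cball 0 C)) ((\<lambda>z. (z, grad z)) ` (- {0}))"
    by (simp add: closedin_closed_Int)
  then show ?thesis
    using C by (subst continuous_closed_graph_eq[where T="cball 0 C"]) auto
qed

section \<open>Orthogonality expressed by the gradient\<close>

text \<open>Smoothness gives the direction from orthogonality to the gradient: the functional that
  vanishes at \<open>w\<close> and equals \<open>N z\<close> at \<open>z\<close> is a support
  functional, so by uniqueness it is the gradient.\<close>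

lemma orthogonal_iff_grad:
  assumes "z \<noteq> 0"
  shows "P z \<bottom>\<^sub>B\<^sub>J P w \<longleftrightarrow> grad z \<bullet> w = 0"
proof
  assume "grad z \<bullet> w = 0"
  then have "grad z \<bullet> (z + r *\<^sub>R w) = N z" for r
    using grad_self[OF assms] by (simp add: inner_add_right)
  then show "P z \<bottom>\<^sub>B\<^sub>J P w"
    unfolding N_orthogonal_iff using grad_le[OF assms] by metis
next
  assume orth: "P z \<bottom>\<^sub>B\<^sub>J P w"
  \<comment> \<open>Up to sign the determinant of \<open>z\<close> and \<open>w\<close>. If it
    vanishes, \<open>w\<close> is a multiple of \<open>z\<close>, and orthogonality forces
    \<open>w = 0\<close>.\<close>
  define d where "d = (\<i> * w) \<bullet> z"
  show "grad z \<bullet> w = 0"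
  proof (cases "d = 0")
    case True
    have "(\<i> * z) \<bullet> w = 0"
      using True by (simp add: d_def inner_complex_def algebra_simps)
    then obtain t where t: "w = t *\<^sub>R z"
      using orthogonal_i_parallel[OF assms] by blast
    have "t = 0"
    proof (rule ccontr)
      assume "t \<noteq> 0"
      then have "N z \<le> 0"
        using orth[unfolded N_orthogonal_iff, rule_format, of "- 1 / t"] by (simp add: t)
      then show False using N_pos[OF assms] by simp
    qed
    then show ?thesis by (simp add: t)
  next
    case False
    define G where "G = (N z / d) *\<^sub>R (\<i> * w)"
    have Gz: "G \<bullet> z = N z"
      using False by (simp add: G_def d_def)
    have Gw: "G \<bullet> w = 0"
      by (simp add: G_def inner_complex_def)
    have "G \<bullet> v \<le> N v" for v
    proof -
      define a where "a = (\<i> * w) \<bullet> v / d"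
      define b where "b = - ((\<i> * z) \<bullet> v / d)"
      have v: "v = a *\<^sub>R z + b *\<^sub>R w"
      proof -
        have "d *\<^sub>R v = ((\<i> * w) \<bullet> v) *\<^sub>R z + (- ((\<i> * z) \<bullet> v)) *\<^sub>R w"
          by (simp add: d_def inner_complex_def complex_eq_iff algebra_simps)
        then have "(1 / d) *\<^sub>R d *\<^sub>R v = (1 / d) *\<^sub>R (((\<i> * w) \<bullet> v) *\<^sub>R z + (- ((\<i> * z) \<bullet> v)) *\<^sub>R w)"
          by simp
        then show ?thesis
          using False unfolding a_def b_def by (simp add: scaleR_diff_right)
      qed
      \<comment> \<open>\<open>a * N z\<close> is the value of \<open>G\<close> at \<open>v\<close>;
        orthogonality is applied to \<open>v\<close> divided by \<open>a\<close>.\<close>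
      have "a * N z \<le> N v"
      proof (cases "a = 0")
        case False
        have "v = a *\<^sub>R (z + (b / a) *\<^sub>R w)"
          using False by (simp add: v scaleR_add_right)
        then have "N v = \<bar>a\<bar> * N (z + (b / a) *\<^sub>R w)"
          by (metis N_scaleR)
        moreover have "\<bar>a\<bar> * N z \<le> \<bar>a\<bar> * N (z + (b / a) *\<^sub>R w)"
          using orth[unfolded N_orthogonal_iff] by (intro mult_left_mono) auto
        moreover have "a * N z \<le> \<bar>a\<bar> * N z"
          by (intro mult_right_mono) auto
        ultimately show ?thesis by linarith
      qed simp
      moreover have "G \<bullet> v = a * N z"
        using Gz Gw by (subst v) (simp add: inner_add_right)
      ultimately show ?thesis by simp
    qed
    then show ?thesis
      using grad_unique[OF assms _ Gz] Gw by blast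
  qed
qed

lemma grad_symmetric:
  assumes "z \<noteq> 0" "w \<noteq> 0"
  shows "grad z \<bullet> w = 0 \<longleftrightarrow> grad w \<bullet> z = 0"
  using radon orthogonal_iff_grad assms by metis

text \<open>For the forward direction, the support inequality at the displaced point
  \<open>z + r *\<^sub>R w\<close> shows that the gradient there is nonnegative on \<open>w\<close>;
  continuity of the gradient lets \<open>r\<close> tend to \<open>0\<close> from the right.\<close>

lemma grad_half_orthogonal:
  assumes "z \<noteq> 0"
  shows "(\<forall>r\<ge>0. N z \<le> N (z + r *\<^sub>R w)) \<longleftrightarrow> 0 \<le> grad z \<bullet> w"
proof
  assume nonneg: "0 \<le> grad z \<bullet> w"
  show "\<forall>r\<ge>0. N z \<le> N (z + r *\<^sub>R w)"
  proof (intro allI impI)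
    fix r :: real assume "r \<ge> 0"
    then have "N z \<le> grad z \<bullet> (z + r *\<^sub>R w)"
      using nonneg grad_self[OF assms] by (simp add: inner_add_right)
    then show "N z \<le> N (z + r *\<^sub>R w)"
      using grad_le[OF assms] order_trans by blast
  qed
next
  assume half: "\<forall>r\<ge>0. N z \<le> N (z + r *\<^sub>R w)"
  have ev: "\<forall>\<^sub>F r in at_right 0. z + r *\<^sub>R w \<noteq> 0"
  proof -
    have "((\<lambda>r. z + r *\<^sub>R w) \<longlongrightarrow> z + 0 *\<^sub>R w) (at_right 0)"
      by (intro tendsto_intros)
    then show ?thesis
      using assms by (intro tendsto_imp_eventually_ne[where c=z]) auto
  qed
  have "isCont grad z"
    using continuous_on_grad assms by (simp add: continuous_on_eq_continuous_at open_Compl)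
  moreover have "((\<lambda>r. z + r *\<^sub>R w) \<longlongrightarrow> z) (at_right 0)"
    by (rule tendsto_eq_intros refl | simp)+
  ultimately have "((\<lambda>r. grad (z + r *\<^sub>R w) \<bullet> w) \<longlongrightarrow> grad z \<bullet> w) (at_right 0)"
    by (intro tendsto_intros) (rule isCont_tendsto_compose)
  moreover have "\<forall>\<^sub>F r in at_right 0. 0 \<le> grad (z + r *\<^sub>R w) \<bullet> w"
    using ev eventually_at_right_less
  proof eventually_elim
    case (elim r)
    have "N z \<le> N (z + r *\<^sub>R w)"
      using half elim by simp
    also have "\<dots> = grad (z + r *\<^sub>R w) \<bullet> z + r * (grad (z + r *\<^sub>R w) \<bullet> w)"
      using grad_self[OF elim(1)] by (simp add: inner_add_right)
    also have "\<dots> \<le> N z + r * (grad (z + r *\<^sub>R w) \<bullet> w)"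
      using grad_le[OF elim(1)] by simp
    finally show ?case
      using elim(2) by (simp add: zero_le_mult_iff)
  qed
  ultimately show "0 \<le> grad z \<bullet> w"
    by (rule tendsto_lowerbound) simp
qed


section \<open>Consequences of the symmetry of orthogonality\<close>

text \<open>By symmetry the gradient at \<open>\<i> * grad z\<close> annihilates \<open>z\<close>,
  so it is a multiple of \<open>\<i> * z\<close>. The factor is positive because both vectors pair
  positively with \<open>\<i> * grad z\<close>.\<close>

lemma sgn_grad_rotate:
  assumes "z \<noteq> 0"
  shows "sgn (grad (\<i> * grad z)) = \<i> * sgn z"
proof -
  define H where "H = grad (\<i> * grad z)"
  define k where "k = H \<bullet> (\<i> * z) / (z \<bullet> z)"
  have nz: "\<i> * grad z \<noteq> 0"
    using grad_nonzero[OF assms] by simp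
  have Hz: "H \<bullet> z = 0"
    using grad_symmetric[OF assms nz] by (simp add: H_def)
  have "(z \<bullet> z) *\<^sub>R H = (H \<bullet> (\<i> * z)) *\<^sub>R (\<i> * z)"
    using expand_in_basis[of z z H] Hz by (simp add: inner_commute)
  then have "(1 / (z \<bullet> z)) *\<^sub>R (z \<bullet> z) *\<^sub>R H = (1 / (z \<bullet> z)) *\<^sub>R (H \<bullet> (\<i> * z)) *\<^sub>R (\<i> * z)"
    by simp
  then have H: "H = k *\<^sub>R (\<i> * z)"
    using assms by (simp add: k_def)
  have "H \<bullet> (\<i> * grad z) = N (\<i> * grad z)"
    unfolding H_def by (rule grad_self[OF nz])
  then have "k * N z = N (\<i> * grad z)"
    using grad_self[OF assms] by (simp add: H inner_commute)
  then have "k > 0"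
    using N_pos[OF assms] N_pos[OF nz] by (metis zero_less_mult_pos2)
  then have "sgn H = \<i> * sgn z"
    unfolding H by (simp add: sgn_scaleR)
  then show ?thesis by (simp add: H_def)
qed

text \<open>On the connected half-plane of all \<open>v\<close> with
  \<open>grad z \<bullet> v > 0\<close>, the continuous function \<open>grad v \<bullet> z\<close>
  has no zero, by symmetry of orthogonality, and it is positive at \<open>v = z\<close>.\<close>

lemma grad_pos_symmetric:
  assumes "z \<noteq> 0" "0 < grad z \<bullet> w"
  shows "0 < grad w \<bullet> z"
proof (rule ccontr)
  assume neg: "\<not> 0 < grad w \<bullet> z"
  let ?H = "{v. grad z \<bullet> v > 0}"
  have sub: "?H \<subseteq> - {0}"
    by auto
  have "connected (grad ` ?H)"
    using continuous_on_subset[OF continuous_on_grad sub] convex_connected[OF convex_halfspace_gt]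
    by (rule connected_continuous_image)
  moreover have "grad w \<in> grad ` ?H" "grad z \<in> grad ` ?H"
    using assms N_pos by (auto simp: grad_self)
  moreover have "z \<bullet> grad w \<le> 0" "0 \<le> z \<bullet> grad z"
    using neg grad_self[OF assms(1)] by (auto simp: inner_commute)
  ultimately obtain v where "grad z \<bullet> v > 0" "z \<bullet> grad v = 0"
    using connected_ivt_hyperplane[of "grad ` ?H" "grad w" "grad z" z 0] by auto
  moreover from this have "v \<noteq> 0"
    by auto
  ultimately show False
    using grad_symmetric[OF assms(1), of v] by (auto simp: inner_commute)
qed

text \<open>\<open>cross_identity\<close> turns the product into
  \<open>N z * N w - (grad w \<bullet> z) * (grad z \<bullet> w)\<close>, which the two support
  inequalities bound below by zero.\<close>

lemma grad_orientation:
  assumes "z \<noteq> 0" "w \<noteq> 0" "0 < grad z \<bullet> w"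
  shows "0 \<le> (z \<bullet> (\<i> * w)) * (grad z \<bullet> (\<i> * grad w))"
proof -
  have "(grad w \<bullet> z) * (grad z \<bullet> w) \<le> N z * N w"
    using assms grad_le by (intro mult_mono) (auto simp: less_imp_le)
  then show ?thesis
    using grad_self assms by (simp add: cross_identity inner_commute)
qed

section \<open>The bisector map and the signs of inner products\<close>

definition S :: "complex \<Rightarrow> complex"
  where "S z = sgn z + sgn (grad z)"

definition T :: "complex \<Rightarrow> complex"
  where "T z = N z *\<^sub>R sgn (S z)"

lemma S_scaleR: "z \<noteq> 0 \<Longrightarrow> r \<noteq> 0 \<Longrightarrow> S (r *\<^sub>R z) = sgn r *\<^sub>R S z"
  unfolding S_def by (simp add: grad_scaleR sgn_scaleR scaleR_add_right)

text \<open>Replacing \<open>z\<close> by \<open>\<i> * grad z\<close> interchanges the two unit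
  vectors in \<open>S\<close>, apart from the factor \<open>\<i>\<close>.\<close>

lemma S_rotate: "z \<noteq> 0 \<Longrightarrow> S (\<i> * grad z) = \<i> * S z"
  by (simp add: S_def sgn_grad_rotate algebra_simps)

lemma S_inner_pos:
  assumes "z \<noteq> 0" "0 < grad z \<bullet> w"
  shows "0 < S z \<bullet> S w"
proof -
  have "w \<noteq> 0"
    using assms by auto
  have "0 < sgn (grad z) \<bullet> sgn z" "0 < sgn (grad z) \<bullet> sgn w" "0 < sgn (grad w) \<bullet> sgn z"
    using assms grad_pos_symmetric N_pos by (simp_all add: sgn_inner_pos_iff grad_self)
  moreover have "0 \<le> (sgn z \<bullet> (\<i> * sgn w)) * (sgn (grad z) \<bullet> (\<i> * sgn (grad w)))"
  proof -
    have "(sgn z \<bullet> (\<i> * sgn w)) * (sgn (grad z) \<bullet> (\<i> * sgn (grad w))) =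
      ((z \<bullet> (\<i> * w)) * (grad z \<bullet> (\<i> * grad w))) / (norm z * norm w * norm (grad z) * norm (grad w))"
      by (simp add: sgn_div_norm divide_inverse)
    also have "\<dots> \<ge> 0"
      using grad_orientation[OF assms(1) \<open>w \<noteq> 0\<close> assms(2)] by simp
    finally show ?thesis .
  qed
  ultimately show ?thesis
    unfolding S_def using assms(1) \<open>w \<noteq> 0\<close> grad_nonzero
    by (intro bisector_inner_pos) (simp_all add: norm_sgn)
qed

lemma S_nonzero: "z \<noteq> 0 \<Longrightarrow> S z \<noteq> 0"
  using S_inner_pos[of z z] N_pos by (auto simp: grad_self)

text \<open>The kernel of \<open>grad z\<close> is spanned by \<open>\<i> * grad z\<close>, and
  \<open>S\<close> at that vector is \<open>S z\<close> turned by a right angle.\<close>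

lemma S_inner_zero:
  assumes "z \<noteq> 0" "w \<noteq> 0" "grad z \<bullet> w = 0"
  shows "S z \<bullet> S w = 0"
proof -
  have "N z *\<^sub>R w = (w \<bullet> (\<i> * z)) *\<^sub>R (\<i> * grad z)"
    using expand_in_basis[of "grad z" z w] assms by (simp add: grad_self)
  then have "(1 / N z) *\<^sub>R N z *\<^sub>R w = (1 / N z) *\<^sub>R (w \<bullet> (\<i> * z)) *\<^sub>R (\<i> * grad z)"
    by simp
  then have w: "w = (w \<bullet> (\<i> * z) / N z) *\<^sub>R (\<i> * grad z)"
    using assms by simp
  then have "w \<bullet> (\<i> * z) / N z \<noteq> 0"
    using assms(2) by (metis scaleR_zero_left)
  then have "S w = sgn (w \<bullet> (\<i> * z) / N z) *\<^sub>R (\<i> * S z)"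
    using S_scaleR[of "\<i> * grad z" "w \<bullet> (\<i> * z) / N z"] grad_nonzero[OF assms(1)] S_rotate[OF assms(1)] w
    by auto
  then show ?thesis by simp
qed

lemma norm_T [simp]: "norm (T z) = N z"
  using S_nonzero by (cases "z = 0") (auto simp: T_def norm_sgn)

lemma T_zero [simp]: "T 0 = 0"
  by (simp add: T_def)

lemma T_scaleR: "T (r *\<^sub>R z) = r *\<^sub>R T z"
proof (cases "r = 0 \<or> z = 0")
  case False
  then show ?thesis
    by (simp add: T_def S_scaleR sgn_scaleR sgn_if)
qed auto

lemma T_minus: "T (- z) = - T z"
  using T_scaleR[of "-1" z] by simp

lemma T_inner_pos:
  assumes "z \<noteq> 0" "0 < grad z \<bullet> w"
  shows "0 < T z \<bullet> T w"
proof -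
  have "w \<noteq> 0" using assms by auto
  then show ?thesis
    using S_inner_pos[OF assms] N_pos assms(1) by (simp add: T_def sgn_inner_pos_iff)
qed

lemma T_inner_zero:
  assumes "z \<noteq> 0" "grad z \<bullet> w = 0"
  shows "T z \<bullet> T w = 0"
proof (cases "w = 0")
  case False
  then show ?thesis
    using S_inner_zero[OF assms(1) False assms(2)] by (simp add: T_def sgn_div_norm)
qed simp

text \<open>The positive and the zero case are known, and the negative case is the positive one for
  \<open>- w\<close>; together they exhaust all signs.\<close>

lemma T_inner_nonneg_iff:
  assumes "z \<noteq> 0"
  shows "0 \<le> T z \<bullet> T w \<longleftrightarrow> 0 \<le> grad z \<bullet> w"
  using T_inner_pos[OF assms, of w] T_inner_pos[OF assms, of "- w"] T_inner_zero[OF assms, of w]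
  by (fastforce simp: T_minus not_le less_le)

lemma T_inner_zero_iff:
  assumes "z \<noteq> 0"
  shows "T z \<bullet> T w = 0 \<longleftrightarrow> grad z \<bullet> w = 0"
  using T_inner_nonneg_iff[OF assms, of w] T_inner_nonneg_iff[OF assms, of "- w"] T_inner_zero[OF assms, of w]
  by (auto simp: T_minus)

text \<open>The hypothesis says that the gradients at \<open>z\<close> and \<open>w\<close> are
  parallel. Symmetry of orthogonality converts this into a condition on the gradient at
  \<open>\<i> * grad w\<close>, which points along \<open>\<i> * w\<close>. This is how strict
  convexity arises from smoothness.\<close>

lemma grad_determines_direction:
  assumes "z \<noteq> 0" "w \<noteq> 0" "grad z \<bullet> (\<i> * grad w) = 0"
  obtains t where "z = t *\<^sub>R w"
proof -
  have nz: "\<i> * grad w \<noteq> 0"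
    using grad_nonzero[OF assms(2)] by simp
  have "grad (\<i> * grad w) \<bullet> z = 0"
    using grad_symmetric[OF assms(1) nz] assms(3) by simp
  then have "sgn (grad (\<i> * grad w)) \<bullet> z = 0"
    by (simp add: sgn_div_norm)
  then have "sgn (\<i> * w) \<bullet> z = 0"
    by (simp add: sgn_grad_rotate[OF assms(2)])
  then have "(\<i> * w) \<bullet> z = 0"
    using assms(2) unfolding sgn_div_norm by simp
  then show ?thesis
    using orthogonal_i_parallel[OF assms(2)] that by blast
qed

section \<open>The bisector map is a homeomorphism\<close>

text \<open>The vector \<open>\<i> * grad w\<close> detects the direction: its image is orthogonal
  to \<open>T w = T z\<close>, so \<open>grad z\<close> annihilates it and \<open>z\<close> is
  parallel to \<open>w\<close>. Homogeneity then fixes the factor.\<close>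

lemma inj_T: "inj T"
proof (rule injI)
  fix z w assume eq: "T z = T w"
  have N: "N z = N w"
    using eq norm_T by metis
  show "z = w"
  proof (cases "w = 0")
    case True
    then show ?thesis using N by simp
  next
    case False
    then have "z \<noteq> 0"
      using N by (metis N_eq_0)
    have "T w \<bullet> T (\<i> * grad w) = 0"
      using False by (simp add: T_inner_zero)
    then have "grad z \<bullet> (\<i> * grad w) = 0"
      using T_inner_zero_iff[OF \<open>z \<noteq> 0\<close>] eq by simp
    then obtain t where t: "z = t *\<^sub>R w"
      using grad_determines_direction[OF \<open>z \<noteq> 0\<close> False] by blast
    moreover have "T w \<noteq> 0"
      using False norm_T[of w] N_eq_0 by (metis norm_zero)
    ultimately have "t = 1"
      using eq t by (metis T_scaleR scaleR_cancel_right scaleR_one)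
    then show ?thesis
      using t by simp
  qed
qed

lemma continuous_on_S: "continuous_on (- {0}) S"
  unfolding S_def using grad_nonzero by (intro continuous_intros continuous_on_grad) auto

text \<open>By the intermediate value theorem between \<open>S 1\<close> and \<open>- S 1\<close> on
  the connected punctured plane, some \<open>S z\<close> is orthogonal to \<open>\<i> * t\<close>,
  hence parallel to \<open>t\<close>.\<close>

lemma surj_T: "surj T"
proof -
  have "t \<in> range T" for t
  proof (cases "t = 0")
    case True
    then show ?thesis
      using T_zero by (metis rangeI)
  next
    case False
    have "S (- 1) = - S 1"
      using S_scaleR[of 1 "-1"] by simp
    then have S1: "S 1 \<in> S ` (- {0})" "- S 1 \<in> S ` (- {0})"
      using imageI[of 1 "- {0}" S] imageI[of "- 1" "- {0}" S] by simp_all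
    have "connected (S ` (- {0}))"
      by (intro connected_continuous_image continuous_on_S connected_punctured_universe) simp
    then obtain z where z: "z \<noteq> 0" "(\<i> * t) \<bullet> S z = 0"
      using connected_ivt_hyperplane[of "S ` (- {0})" "S 1" "- S 1" "\<i> * t" 0]
        connected_ivt_hyperplane[of "S ` (- {0})" "- S 1" "S 1" "\<i> * t" 0] S1
      by (cases "(\<i> * t) \<bullet> S 1 \<le> 0") auto
    obtain k where k: "S z = k *\<^sub>R t"
      using orthogonal_i_parallel[OF False z(2)] by blast
    have "k \<noteq> 0"
      using k S_nonzero[OF z(1)] by auto
    \<comment> \<open>The factor corrects the length \<open>N z\<close> to \<open>norm t\<close>,
      and \<open>sgn k\<close> reverses the vector if \<open>S z\<close> points opposite to
      \<open>t\<close>.\<close>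
    have "T ((norm t * sgn k / N z) *\<^sub>R z) = t"
      using z(1) \<open>k \<noteq> 0\<close> False
      by (simp add: T_scaleR) (auto simp: T_def k sgn_scaleR sgn_div_norm[of t] sgn_if)
    then show ?thesis by (metis rangeI)
  qed
  then show ?thesis by blast
qed

lemma continuous_on_T: "continuous_on UNIV T"
proof -
  have "isCont T z" for z
  proof (cases "z = 0")
    case True
    \<comment> \<open>The direction of \<open>T\<close> has no limit to rely on at \<open>0\<close>,
      but its length \<open>N\<close> tends to zero.\<close>
    have "(N \<longlongrightarrow> 0) (at 0)"
      using continuous_on_N[of UNIV] by (metis N_zero UNIV_I continuous_on_def)
    then have "(T \<longlongrightarrow> 0) (at 0)"
      by (rule Lim_null_comparison[rotated]) simp
    then show ?thesis by (simp add: True isCont_def)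
  next
    case False
    have "continuous_on (- {0}) T"
      unfolding T_def using S_nonzero by (intro continuous_intros continuous_on_N continuous_on_S) auto
    then show ?thesis
      using False by (simp add: continuous_on_eq_continuous_at open_Compl)
  qed
  then show ?thesis
    by (simp add: continuous_on_eq_continuous_at)
qed

text \<open>Invariance of domain makes a continuous injection of the plane into itself a
  homeomorphism onto its image.\<close>

lemma continuous_on_inv_T: "continuous_on UNIV (inv T)"
proof -
  obtain g where "homeomorphism UNIV (T ` UNIV) T g"
    using invariance_of_domain_homeomorphism[OF open_UNIV continuous_on_T] inj_T by auto
  then have g: "continuous_on UNIV g" "\<And>x. g (T x) = x"
    using surj_T by (auto simp: homeomorphism_def)
  have "inv T = g"
    using g(2) surj_T inj_T by (metis ext inv_f_f surj_f_inv_f)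
  then show ?thesis using g(1) by simp
qed

section \<open>Strict convexity and transfer to the Radon plane\<close>

text \<open>The functional \<open>grad z\<close> attains \<open>N z\<close> also at
  \<open>z + w\<close>, so it is the gradient there too, and points with parallel gradients are
  parallel.\<close>

lemma strictly_convex:
  assumes "z \<noteq> 0" "N (z + w) \<le> N z" "N (z - w) \<le> N z"
  shows "w = 0"
proof (rule ccontr)
  assume "w \<noteq> 0"
  let ?G = "grad z"
  have "?G \<bullet> (z + w) \<le> N z" "?G \<bullet> (z - w) \<le> N z"
    using assms grad_le[OF assms(1)] order_trans by blast+
  then have Gw: "?G \<bullet> w = 0"
    using grad_self[OF assms(1)] by (simp add: inner_add_right inner_diff_right)
  then have Gzw: "?G \<bullet> (z + w) = N z"
    using grad_self[OF assms(1)] by (simp add: inner_add_right)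
  then have "z + w \<noteq> 0" 
    using N_pos[OF assms(1)] by auto
  moreover have "N (z + w) = N z"
    using Gzw grad_le[OF assms(1), of "z + w"] assms(2) by simp
  ultimately have "grad (z + w) = ?G"
    using Gzw grad_le[OF assms(1)] by (intro grad_unique) auto
  then obtain t where t: "z + w = t *\<^sub>R z"
    using grad_determines_direction[OF \<open>z + w \<noteq> 0\<close> assms(1)] by auto
  then have "t = 1"
    using Gzw grad_self[OF assms(1)] assms(1) by simp
  then show False
    using t \<open>w \<noteq> 0\<close> by simp
qed

text \<open>Compactness of the Euclidean unit circle; this makes the inverse of the chart
  bounded.\<close>

lemma norm_lower_bound:
  obtains m where "m > 0" "\<And>z. m * norm z \<le> N z"
proof -
  have "\<exists>x\<in>sphere (0::complex) 1. \<forall>y\<in>sphere 0 1. N x \<le> N y"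
    by (intro continuous_attains_inf continuous_on_N) auto
  then obtain x where x: "norm x = 1" "\<And>y. norm y = 1 \<Longrightarrow> N x \<le> N y"
    by auto
  have "N x * norm z \<le> N z" for z
  proof (cases "z = 0")
    case False
    then have "N x \<le> N (sgn z)"
      by (intro x) (simp add: norm_sgn)
    then show ?thesis
      using False by (simp add: sgn_div_norm field_simps)
  qed simp
  moreover have "N x > 0"
    using x by (intro N_pos) auto
  ultimately show ?thesis using that by blast
qed

lemma half_orthogonal_chart_iff: "half_orthogonal (P z) (P w) \<longleftrightarrow> half_orthogonal (T z) (T w)"
proof (cases "z = 0")
  case True
  then show ?thesis
    by (simp add: linear_0[OF linear_P])
next
  case False
  have "half_orthogonal (P z) (P w) \<longleftrightarrow> (\<forall>r\<ge>0. N z \<le> N (z + r *\<^sub>R w))"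
    by (simp add: half_orthogonal_def N_def linear_add[OF linear_P] linear_cmul[OF linear_P])
  then show ?thesis
    using grad_half_orthogonal[OF False] T_inner_nonneg_iff[OF False]
    by (simp add: half_orthogonal_iff_inner)
qed

lemma bj_map_to_plane:
  assumes "surj P"
  obtains F :: "'x \<Rightarrow> real^2" where "norm_preserving F" "homogeneous_map F" "bij F" "bicontinuous F"
    "\<And>x y. half_orthogonal (F x) (F y) \<longleftrightarrow> half_orthogonal x y"
proof -
  obtain g :: "complex \<Rightarrow> real^2" and h :: "real^2 \<Rightarrow> complex" where gh: "linear g" "linear h" "\<And>z. norm (g z) = norm z"
    "\<And>x. norm (h x) = norm x" "\<And>z. h (g z) = z" "\<And>x. g (h x) = x"
    by (rule complex_isometry_plane, rule that)
  have bij_P: "bij P"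
    using assms inj_P by (simp add: bij_def)
  define Q where "Q = inv P"
  have PQ: "P (Q x) = x" and QP: "Q (P z) = z" for x z
    using bij_P by (simp_all add: Q_def bij_is_inj bij_is_surj surj_f_inv_f)
  have NQ: "N (Q x) = norm x" for x
    by (simp add: N_def PQ)
  have Q_scaleR: "Q (r *\<^sub>R x) = r *\<^sub>R Q x" and Q_add: "Q (x + y) = Q x + Q y" for r x y
    using QP[of "r *\<^sub>R Q x"] QP[of "Q x + Q y"]
    by (simp_all add: linear_cmul[OF linear_P] linear_add[OF linear_P] PQ)
  obtain m where m: "m > 0" "\<And>z. m * norm z \<le> N z"
    by (rule norm_lower_bound) blast
  have "bounded_linear Q"
  proof (rule bounded_linear_intro[where K="1 / m"])
    show "norm (Q x) \<le> norm x * (1 / m)" for x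
      using m(2)[of "Q x"] m(1) by (simp add: NQ field_simps)
  qed (simp_all add: Q_scaleR Q_add)
  note contQ = linear_continuous_on[OF this]
  have contP: "continuous_on A P" for A
    using linear_P by (intro linear_continuous_on) (simp add: linear_conv_bounded_linear)
  have contg: "continuous_on A g" and conth: "continuous_on B h" for A B
    using gh(1,2) by (intro linear_continuous_on; simp add: linear_conv_bounded_linear)+
  \<comment> \<open>Into the chart, through the bisector map, then by a linear isometry onto
    \<open>real^2\<close>.\<close>
  define F where "F x = g (T (Q x))" for x
  have normF: "norm (F x) = norm x" for x
    by (simp add: F_def gh NQ)
  have homF: "F (c *\<^sub>R x) = c *\<^sub>R F x" for c x
    by (simp add: F_def Q_scaleR T_scaleR linear_cmul[OF gh(1)])
  have FG: "F (P (inv T (h y))) = y" and GF: "P (inv T (h (F x))) = x" for x y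
    by (simp_all add: F_def QP PQ gh surj_f_inv_f[OF surj_T] inj_T)
  have bijF: "bij F"
    by (rule o_bij[of "\<lambda>y. P (inv T (h y))"]) (auto simp: FG GF)
  have "inv F = (\<lambda>y. P (inv T (h y)))"
    by (intro inv_equality FG GF)
  moreover have "continuous_on UNIV (\<lambda>y. P (inv T (h y)))"
    by (rule continuous_on_compose2[OF contP[of UNIV]
        continuous_on_compose2[OF continuous_on_inv_T conth]]) auto
  moreover have "continuous_on UNIV F"
    unfolding F_def by (rule continuous_on_compose2[OF contg[of UNIV]
        continuous_on_compose2[OF continuous_on_T contQ]]) auto
  ultimately have "bicontinuous F"
    by (simp add: bicontinuous_def)
  moreover have "half_orthogonal (F x) (F y) \<longleftrightarrow> half_orthogonal x y" for x y
  proof -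
    have "half_orthogonal (F x) (F y) \<longleftrightarrow> half_orthogonal (T (Q x)) (T (Q y))"
      by (simp add: half_orthogonal_def F_def gh(3) flip: linear_cmul[OF gh(1)] linear_add[OF gh(1)])
    then show ?thesis
      using half_orthogonal_chart_iff[of "Q x" "Q y"] by (simp add: PQ)
  qed
  ultimately show ?thesis
    using that[of F] bijF by (simp add: norm_preserving_def homogeneous_map_def normF homF)
qed

lemma norm_strictly_convex:
  fixes x y :: 'x
  assumes "surj P" "x \<noteq> 0" "norm (x + y) \<le> norm x" "norm (x - y) \<le> norm x"
  shows "y = 0"
proof -
  obtain z where z: "x = P z"
    by (rule surjE[OF assms(1), of x], rule that)
  obtain w where w: "y = P w"
    by (rule surjE[OF assms(1), of y], rule that)
  have "z \<noteq> 0"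
    using assms(2) z linear_0[OF linear_P] by auto
  moreover have "N (z + w) \<le> N z"
    using assms(3) by (simp add: z w N_def linear_add[OF linear_P])
  moreover have "N (z - w) \<le> N z"
    using assms(4) by (simp add: z w N_def linear_diff[OF linear_P])
  ultimately have "w = 0"
    by (rule strictly_convex)
  then show ?thesis
    using w linear_0[OF linear_P] by simp
qed

end


section \<open>Maximum-norm sums with spaces of null systems\<close>

text \<open>Shorter vectors stay short by continuity. If \<open>x\<close> is norming but not
  half-orthogonal to \<open>y\<close>, the norm is below \<open>M\<close> at some
  \<open>s > 0\<close>, and by convexity on all of the interval up to \<open>s\<close>.\<close>

lemma eventually_norm_less:
  fixes x y :: "'a::real_normed_vector"
  assumes "norm x \<le> M" "\<not> (norm x = M \<and> half_orthogonal x y)"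
  shows "\<forall>\<^sub>F r in at_right 0. norm (x + r *\<^sub>R y) < M"
proof (cases "norm x < M")
  case True
  have "((\<lambda>r. norm (x + r *\<^sub>R y)) \<longlongrightarrow> norm (x + 0 *\<^sub>R y)) (at_right 0)"
    by (intro tendsto_intros)
  then show ?thesis
    using True by (intro order_tendstoD) auto
next
  case False
  then obtain s where s: "s \<ge> 0" "norm (x + s *\<^sub>R y) < M" and M: "norm x = M"
    using assms by (auto simp: half_orthogonal_def not_le)
  then have "s > 0"
    by (cases "s = 0") auto
  have "norm (x + r *\<^sub>R y) < M" if "0 < r" "r < s" for r
  proof -
    have "x + r *\<^sub>R y = (1 - r / s) *\<^sub>R x + (r / s) *\<^sub>R (x + s *\<^sub>R y)"
      using \<open>s > 0\<close> by (simp add: algebra_simps)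
    then have "norm (x + r *\<^sub>R y) \<le> (1 - r / s) * norm x + (r / s) * norm (x + s *\<^sub>R y)"
      using that by (metis (no_types, lifting) abs_of_nonneg diff_ge_0_iff_ge divide_le_eq_1_pos
          divide_nonneg_pos less_imp_le norm_scaleR norm_triangle_ineq order_less_trans)
    also have "\<dots> < (1 - r / s) * M + (r / s) * M"
      using that s M by (intro add_le_less_mono mult_strict_left_mono) auto
    finally show ?thesis by (simp add: algebra_simps)
  qed
  then show ?thesis
    using \<open>s > 0\<close> by (auto simp: eventually_at_right_field)
qed

lemma finite_large_coord: "0 < e \<Longrightarrow> finite {n. e \<le> \<bar>coord a n\<bar>}"
  using coord[of a] by (simp add: null_system_def)

text \<open>Only finitely many coordinates reach half of the norm, so the supremum is a maximum over
  these.\<close>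

lemma c0_norm_attained:
  fixes a :: "'i c0"
  obtains n where "\<bar>coord a n\<bar> = norm a"
proof (cases "a = 0")
  case True
  then show ?thesis
    using that by (simp add: zero_c0.rep_eq)
next
  case False
  define F where "F = {n. \<bar>coord a n\<bar> \<ge> norm a / 2}"
  have "finite F"
    using finite_large_coord[of "norm a / 2" a] False by (simp add: F_def)
  \<comment> \<open>Inserting \<open>norm a / 2\<close> keeps the finite set nonempty and lets
    \<open>m\<close> dominate the coordinates outside \<open>F\<close> as well.\<close>
  define m where "m = Max (insert (norm a / 2) ((\<lambda>n. \<bar>coord a n\<bar>) ` F))"
  have m: "m \<in> insert (norm a / 2) ((\<lambda>n. \<bar>coord a n\<bar>) ` F)"
    unfolding m_def using \<open>finite F\<close> by (intro Max_in) auto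
  have "\<bar>coord a n\<bar> \<le> m" for n
  proof (cases "n \<in> F")
    case True
    then show ?thesis
      unfolding m_def using \<open>finite F\<close> by (intro Max_ge) auto
  next
    case False
    then have "\<bar>coord a n\<bar> \<le> norm a / 2"
      by (simp add: F_def)
    also have "\<dots> \<le> m"
      unfolding m_def using \<open>finite F\<close> by (intro Max_ge) auto
    finally show ?thesis .
  qed
  then have "norm a \<le> m"
    by (rule norm_c0_least)
  moreover have "0 < norm a"
    using False by simp
  ultimately have "m \<noteq> norm a / 2"
    by linarith
  then obtain n where "m = \<bar>coord a n\<bar>"
    using m by auto
  then show ?thesis
    using that \<open>norm a \<le> m\<close> abs_coord_le_norm[of a n] by (metis order_antisym)
qed

abbreviation left :: "'a \<oplus>\<^sub>\<infinity> 'b \<Rightarrow> 'a"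
  where "left u \<equiv> fst (pair_of u)"

abbreviation right :: "'a \<oplus>\<^sub>\<infinity> 'b \<Rightarrow> 'b"
  where "right u \<equiv> snd (pair_of u)"

lemma norm_max_sum: "norm u = max (norm (left u)) (norm (right u))"
  by transfer auto

lemma norm_left_le: "norm (left u) \<le> norm u"
  and norm_right_le: "norm (right u) \<le> norm u"
  by (simp_all add: norm_max_sum)

lemmas max_sum_rep_eq [simp] = plus_max_sum.rep_eq minus_max_sum.rep_eq uminus_max_sum.rep_eq
  scaleR_max_sum.rep_eq zero_max_sum.rep_eq of_pair_inverse[OF UNIV_I]

lemma max_sum_eqI: "left u = left v \<Longrightarrow> right u = right v \<Longrightarrow> u = v"
  by (simp add: pair_of_inject[symmetric] prod_eq_iff)

lemma bounded_linear_left: "bounded_linear (left :: ('a::real_normed_vector \<oplus>\<^sub>\<infinity> 'b::real_normed_vector) \<Rightarrow> 'a)"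
  by (rule bounded_linear_intro[where K=1]) (simp_all add: norm_left_le)

lemma bounded_linear_right: "bounded_linear (right :: ('a::real_normed_vector \<oplus>\<^sub>\<infinity> 'b::real_normed_vector) \<Rightarrow> 'b)"
  by (rule bounded_linear_intro[where K=1]) (simp_all add: norm_right_le)

lemma continuous_on_of_pair:
  fixes f :: "'c::topological_space \<Rightarrow> 'a::real_normed_vector" and g :: "'c \<Rightarrow> 'b::real_normed_vector"
  assumes "continuous_on A f" "continuous_on A g"
  shows "continuous_on A (\<lambda>x. of_pair (f x, g x))"
proof -
  have l: "bounded_linear (\<lambda>x::'a. of_pair (x, 0::'b))"
    by (rule bounded_linear_intro[where K=1]) (auto intro!: max_sum_eqI simp: norm_of_pair)
  have r: "bounded_linear (\<lambda>y::'b. of_pair (0::'a, y))"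
    by (rule bounded_linear_intro[where K=1]) (auto intro!: max_sum_eqI simp: norm_of_pair)
  have eq: "of_pair (f x, g x) = of_pair (f x, 0) + of_pair (0, g x)" for x
    by (intro max_sum_eqI) simp_all
  show ?thesis
    using assms by (subst eq) (intro continuous_intros bounded_linear.continuous_on[OF l] bounded_linear.continuous_on[OF r])
qed

text \<open>If no norming component is half-orthogonal, every component falls below the norm of
  \<open>u\<close> for small \<open>r > 0\<close>: the left one and the finitely many large
  coordinates by \<open>eventually_norm_less\<close>, the others uniformly because they start from
  at most half of that norm.\<close>

lemma half_orthogonal_max_sum_iff:
  fixes u v :: "('a::real_normed_vector) \<oplus>\<^sub>\<infinity> 'i c0"
  shows "half_orthogonal u v \<longleftrightarrow> norm (left u) = norm u \<and> half_orthogonal (left u) (left v) \<or>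
    (\<exists>n. \<bar>coord (right u) n\<bar> = norm u \<and> half_orthogonal (coord (right u) n) (coord (right v) n))"
    (is "_ \<longleftrightarrow> ?L \<or> ?R")
proof
  assume half: "half_orthogonal u v"
  show "?L \<or> ?R"
  proof (rule ccontr)
    assume none: "\<not> (?L \<or> ?R)"
    then have "u \<noteq> 0"
      by auto
    define M where "M = norm u"
    have "M > 0"
      using \<open>u \<noteq> 0\<close> by (simp add: M_def)
    let ?a = "right u" and ?b = "right v"
    define F where "F = {n. \<bar>coord ?a n\<bar> \<ge> M / 2}"
    have "finite F"
      using finite_large_coord[of "M / 2" ?a] \<open>M > 0\<close> by (simp add: F_def)
    have "\<bar>coord ?a n\<bar> \<le> M" for n
      unfolding M_def by (rule order_trans[OF abs_coord_le_norm norm_right_le])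
    then have "\<forall>n\<in>F. \<forall>\<^sub>F r in at_right 0. norm (coord ?a n + r *\<^sub>R coord ?b n) < M"
      using none unfolding M_def by (intro ballI eventually_norm_less) (simp, auto)
    then have evF: "\<forall>\<^sub>F r in at_right 0. \<forall>n\<in>F. \<bar>coord ?a n + r * coord ?b n\<bar> < M"
      using \<open>finite F\<close> by (subst eventually_ball_finite_distrib) auto
    have evL: "\<forall>\<^sub>F r in at_right 0. norm (left u + r *\<^sub>R left v) < M"
      using none norm_left_le[of u] by (intro eventually_norm_less) (auto simp: M_def)
    have "((\<lambda>r. M / 2 + r * norm ?b) \<longlongrightarrow> M / 2 + 0 * norm ?b) (at_right 0)"
      by (intro tendsto_intros)
    then have "\<forall>\<^sub>F r in at_right 0. M / 2 + r * norm ?b < M"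
      by (rule order_tendstoD(2)) (use \<open>M > 0\<close> in simp)
    then have "\<forall>\<^sub>F r in at_right 0. r > 0 \<and> norm (u + r *\<^sub>R v) < M"
      using evF evL eventually_at_right_less
    proof eventually_elim
      case (elim r)
      \<comment> \<open>Since the supremum is attained, strict bounds on the coordinates give a
        strict bound on the norm.\<close>
      obtain n where n: "\<bar>coord (?a + r *\<^sub>R ?b) n\<bar> = norm (?a + r *\<^sub>R ?b)"
        by (rule c0_norm_attained)
      have "\<bar>coord ?a n + r * coord ?b n\<bar> < M"
      proof (cases "n \<in> F")
        case True
        then show ?thesis using elim by blast
      next
        case False
        then have "\<bar>coord ?a n\<bar> \<le> M / 2"
          by (simp add: F_def)
        moreover have "\<bar>r * coord ?b n\<bar> \<le> r * norm ?b"
          using abs_coord_le_norm[of ?b n] elim by (simp add: abs_mult)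
        ultimately show ?thesis
          using elim(1) by linarith
      qed
      then show ?case
        using n elim by (simp add: norm_max_sum[of "u + _"] plus_c0.rep_eq scaleR_c0.rep_eq)
    qed
    then obtain r where "r > 0" "norm (u + r *\<^sub>R v) < norm u"
      using eventually_happens'[OF trivial_limit_at_right_real] unfolding M_def by blast
    then show False
      using half by (auto simp: half_orthogonal_def not_le[symmetric])
  qed
next
  assume "?L \<or> ?R"
  then show "half_orthogonal u v"
  proof
    assume L: ?L
    show ?thesis
      unfolding half_orthogonal_def
    proof (intro allI impI)
      fix r :: real assume "0 \<le> r"
      have "half_orthogonal (left u) (left v)" and eq: "norm (left u) = norm u"
        using L by blast+
      then have "norm (left u) \<le> norm (left u + r *\<^sub>R left v)"
        using \<open>0 \<le> r\<close> unfolding half_orthogonal_def by blast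
      then have "norm u \<le> norm (left (u + r *\<^sub>R v))"
        unfolding eq by simp
      then show "norm u \<le> norm (u + r *\<^sub>R v)"
        by (rule order_trans[OF _ norm_left_le])
    qed
  next
    assume ?R
    then obtain n where n: "\<bar>coord (right u) n\<bar> = norm u"
      "half_orthogonal (coord (right u) n) (coord (right v) n)"
      by blast
    show ?thesis
      unfolding half_orthogonal_def
    proof (intro allI impI)
      fix r :: real assume "0 \<le> r"
      then have "norm u \<le> \<bar>coord (right (u + r *\<^sub>R v)) n\<bar>"
        using n by (simp add: half_orthogonal_def plus_c0.rep_eq scaleR_c0.rep_eq)
      then show "norm u \<le> norm (u + r *\<^sub>R v)"
        by (rule order_trans[OF _ order_trans[OF abs_coord_le_norm norm_right_le]])
    qed
  qed
qed

lemma bj_equivalent_max_sum_c0: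
  fixes T :: "'x::banach \<Rightarrow> 'w::banach"
  assumes norm: "norm_preserving T" and hom: "homogeneous_map T" and bij: "bij T"
    and cont: "bicontinuous T"
    and half: "\<And>x y. half_orthogonal (T x) (T y) \<longleftrightarrow> half_orthogonal x y"
  shows "TYPE('x \<oplus>\<^sub>\<infinity> 'i c0) =\<^sub>B\<^sub>J TYPE('w \<oplus>\<^sub>\<infinity> 'i c0)"
proof -
  define F :: "'x \<oplus>\<^sub>\<infinity> 'i c0 \<Rightarrow> 'w \<oplus>\<^sub>\<infinity> 'i c0" where "F u = of_pair (T (left u), right u)" for u
  define G :: "'w \<oplus>\<^sub>\<infinity> 'i c0 \<Rightarrow> 'x \<oplus>\<^sub>\<infinity> 'i c0" where "G u = of_pair (inv T (left u), right u)" for u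
  have GF: "G (F u) = u" for u
    unfolding F_def G_def using bij by (intro max_sum_eqI) (auto simp: bij_is_inj)
  have FG: "F (G u) = u" for u
    unfolding F_def G_def using bij by (intro max_sum_eqI) (auto simp: bij_is_surj surj_f_inv_f)
  have bijF: "bij F"
    using GF FG by (intro o_bij[of G]) auto
  have invF: "inv F = G"
    using GF FG by (intro inv_equality)
  have normF: "norm (F u) = norm u" for u
    using norm by (simp add: F_def norm_max_sum norm_preserving_def)
  have homF: "F (c *\<^sub>R u) = c *\<^sub>R F u" for c u
    using hom by (intro max_sum_eqI) (simp_all add: F_def homogeneous_map_def)
  have contT: "continuous_on A T" "continuous_on B (inv T)" for A B
    using cont unfolding bicontinuous_def by (auto intro: continuous_on_subset[OF _ subset_UNIV])
  note left = linear_continuous_on[OF bounded_linear_left]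
    and right = linear_continuous_on[OF bounded_linear_right]
  have "continuous_on UNIV F" "continuous_on UNIV G"
    unfolding F_def G_def
    by (rule continuous_on_of_pair[OF continuous_on_compose2[OF contT(1)[of UNIV] left subset_UNIV] right]
        continuous_on_of_pair[OF continuous_on_compose2[OF contT(2)[of UNIV] left subset_UNIV] right])+
  then have "bicontinuous F"
    by (simp add: bicontinuous_def invF)
  moreover have halfF: "half_orthogonal (F u) (F v) \<longleftrightarrow> half_orthogonal u v" for u v
    unfolding half_orthogonal_max_sum_iff normF using half norm by (simp add: F_def norm_preserving_def)
  \<comment> \<open>Oddness carries both one-sided conditions, for \<open>v\<close> and for
    \<open>- v\<close>, through \<open>F\<close>.\<close>
  have minusF: "F (- v) = - F v" for v
    using homF[of "-1" v] by simp
  then have "bj_preserver F"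
    unfolding bj_preserver_def bj_orthogonal_iff_half using bijF 
    by (simp only: minusF[symmetric] halfF) simp
  ultimately show ?thesis
    unfolding bj_equivalent_def
    by (intro exI[of _ F]) (simp add: norm_preserving_def homogeneous_map_def normF homF)
qed

section \<open>Splitting off lines, and isometries\<close>

text \<open>The pairs \<open>(u, \<phi>)\<close> below correspond to the decompositions of the whole space as a
  maximum-norm sum of a line and a hyperplane.\<close>

definition M_pair :: "'a::real_normed_vector \<Rightarrow> ('a \<Rightarrow> real) \<Rightarrow> bool"
  where "M_pair u \<phi> \<longleftrightarrow> linear \<phi> \<and> \<phi> u = 1 \<and> (\<forall>v. norm v = max \<bar>\<phi> v\<bar> (norm (v - \<phi> v *\<^sub>R u)))"

lemma M_pairD:
  assumes "M_pair u \<phi>"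
  shows "linear \<phi>" "\<phi> u = 1" "norm v = max \<bar>\<phi> v\<bar> (norm (v - \<phi> v *\<^sub>R u))"
  using assms[unfolded M_pair_def, THEN conjunct1]
    assms[unfolded M_pair_def, THEN conjunct2, THEN conjunct1]
    assms[unfolded M_pair_def, THEN conjunct2, THEN conjunct2, THEN spec] .

lemma linear_of_pair_left: "linear (\<lambda>x. of_pair (x, 0))"
  by (intro linearI max_sum_eqI) auto

text \<open>A nonzero \<open>x0\<close> in the left summand with \<open>\<phi>\<close> zero there
  can be perturbed by small multiples of \<open>u\<close> without increasing its norm, so strict
  convexity gives \<open>left u = 0\<close>. Then \<open>u\<close> lies in the right summand, and
  adding a multiple of \<open>u\<close> of norm \<open>norm x\<close> to \<open>x\<close> leaves the
  norm unchanged, which leaves no room for a nonzero \<open>\<phi>\<close> at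
  \<open>x\<close>.\<close>

lemma M_pair_vanishes_on_strictly_convex:
  fixes u :: "'x::real_normed_vector \<oplus>\<^sub>\<infinity> 'b::real_normed_vector"
  assumes strict: "\<And>x y::'x. x \<noteq> 0 \<Longrightarrow> norm (x + y) \<le> norm x \<Longrightarrow> norm (x - y) \<le> norm x \<Longrightarrow> y = 0"
    and kernel: "\<And>f :: 'x \<Rightarrow> real. linear f \<Longrightarrow> \<exists>x. x \<noteq> 0 \<and> f x = 0"
    and pair: "M_pair u \<phi>"
  shows "\<phi> (of_pair (x, 0)) = 0"
proof -
  note lin = M_pairD(1)[OF pair] and norm = M_pairD(3)[OF pair]
  note [simp] = M_pairD(2)[OF pair] linear_add[OF lin] linear_cmul[OF lin] linear_diff[OF lin]
  have "linear (\<lambda>x. \<phi> (of_pair (x, 0)))"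
    using linear_compose[OF linear_of_pair_left lin] by (simp add: o_def)
  then obtain x0 where x0: "x0 \<noteq> 0" "\<phi> (of_pair (x0, 0)) = 0"
    using kernel by blast
  have bound: "norm (x0 + s *\<^sub>R left u) \<le> norm x0" if "\<bar>s\<bar> \<le> norm x0" for s
  proof -
    have "norm (x0 + s *\<^sub>R left u) \<le> norm (of_pair (x0, 0) + s *\<^sub>R u)"
      using norm_left_le[of "of_pair (x0, 0) + s *\<^sub>R u"] by simp
    also have "\<dots> \<le> norm x0"
      using that by (subst norm) (simp add: x0 norm_of_pair)
    finally show ?thesis .
  qed
  have "norm x0 *\<^sub>R left u = 0"
    using bound[of "norm x0"] bound[of "- norm x0"] by (intro strict[OF x0(1)]) simp_all
  then have left_u: "left u = 0"
    using x0 by simp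
  have "norm u = 1"
    using norm[of u] by simp
  define t where "t = \<phi> (of_pair (x, 0))"
  \<comment> \<open>The sign agrees with that of \<open>t\<close>, so that
    \<open>\<bar>t + r\<bar> = \<bar>t\<bar> + norm x\<close>.\<close>
  define r where "r = (if t \<ge> 0 then norm x else - norm x)"
  have "\<bar>t + r\<bar> \<le> norm (of_pair (x, 0) + r *\<^sub>R u)"
    by (subst norm) (simp add: t_def)
  also have "\<dots> = max (norm x) \<bar>r\<bar>"
    using \<open>norm u = 1\<close> by (simp add: norm_max_sum left_u)
  also have "\<dots> = norm x"
    by (simp add: r_def)
  finally show ?thesis
    unfolding t_def[symmetric] by (auto simp: r_def split: if_splits)
qed

definition unit_system :: "'i \<Rightarrow> 'i c0"
  where "unit_system n = c0_of (\<lambda>m. if m = n then 1 else 0)"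

lemma coord_unit_system: "coord (unit_system n) m = (if m = n then 1 else 0)"
proof -
  have "null_system (\<lambda>m. if m = n then 1 else 0)"
    unfolding null_system_def
  proof (intro allI impI)
    fix \<epsilon> :: real assume "\<epsilon> > 0"
    then have "{m. \<bar>if m = n then 1 else 0\<bar> \<ge> \<epsilon>} \<subseteq> {n}"
      by auto
    then show "finite {m. \<bar>if m = n then 1 else 0\<bar> \<ge> \<epsilon>}"
      using finite_subset by blast
  qed
  then show ?thesis
    by (simp add: unit_system_def c0_of_inverse)
qed

lemma norm_c0_split: "norm a = max \<bar>coord a n\<bar> (norm (a - coord a n *\<^sub>R unit_system n))"
proof (rule antisym)
  have "\<bar>coord a m\<bar> \<le> max \<bar>coord a n\<bar> (norm (a - coord a n *\<^sub>R unit_system n))" for m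
    using abs_coord_le_norm[of "a - coord a n *\<^sub>R unit_system n" m]
    by (cases "m = n") (auto simp: minus_c0.rep_eq scaleR_c0.rep_eq coord_unit_system)
  then show "norm a \<le> max \<bar>coord a n\<bar> (norm (a - coord a n *\<^sub>R unit_system n))"
    by (rule norm_c0_least)
  have "norm (a - coord a n *\<^sub>R unit_system n) \<le> norm a"
    by (rule norm_c0_least) (simp add: minus_c0.rep_eq scaleR_c0.rep_eq coord_unit_system abs_coord_le_norm)
  then show "max \<bar>coord a n\<bar> (norm (a - coord a n *\<^sub>R unit_system n)) \<le> norm a"
    by (simp add: abs_coord_le_norm)
qed

lemma M_pair_unit_system:
  "M_pair (of_pair (0::'w::real_normed_vector, unit_system n)) (\<lambda>v. coord (right v) n)"
  unfolding M_pair_def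
proof (intro conjI allI)
  show "linear (\<lambda>v :: 'w \<oplus>\<^sub>\<infinity> 'a c0. coord (right v) n)"
    by (intro linearI) (simp_all add: plus_c0.rep_eq scaleR_c0.rep_eq)
  fix v :: "'w \<oplus>\<^sub>\<infinity> 'a c0"
  let ?c = "coord (right v) n"
  have "norm v = max (norm (left v)) (norm (right v))"
    by (rule norm_max_sum)
  also have "norm (right v) = max \<bar>?c\<bar> (norm (right v - ?c *\<^sub>R unit_system n))"
    by (rule norm_c0_split)
  also have "max (norm (left v)) \<dots> =
      max \<bar>?c\<bar> (norm (v - ?c *\<^sub>R of_pair (0, unit_system n)))"
    by (simp add: norm_max_sum[of "v - _"] max.left_commute)
  finally show "norm v = max \<bar>?c\<bar> (norm (v - ?c *\<^sub>R of_pair (0, unit_system n)))" .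
qed (simp add: coord_unit_system)

lemma M_pair_pullback:
  assumes "linear U" "\<And>v. norm (U v) = norm v" "M_pair (U u) \<phi>"
  shows "M_pair u (\<lambda>v. \<phi> (U v))"
  unfolding M_pair_def
proof (intro conjI allI)
  show "linear (\<lambda>v. \<phi> (U v))"
    using linear_compose[OF assms(1) M_pairD(1)[OF assms(3)]] by (simp add: o_def)
  show "\<phi> (U u) = 1"
    by (rule M_pairD(2)[OF assms(3)])
  fix v
  have "norm v = norm (U v)"
    by (rule assms(2)[symmetric])
  also have "\<dots> = max \<bar>\<phi> (U v)\<bar> (norm (U v - \<phi> (U v) *\<^sub>R U u))"
    by (rule M_pairD(3)[OF assms(3)])
  also have "U v - \<phi> (U v) *\<^sub>R U u = U (v - \<phi> (U v) *\<^sub>R u)"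
    by (simp add: linear_diff[OF assms(1)] linear_cmul[OF assms(1)])
  also have "norm \<dots> = norm (v - \<phi> (U v) *\<^sub>R u)"
    by (rule assms(2))
  finally show "norm v = max \<bar>\<phi> (U v)\<bar> (norm (v - \<phi> (U v) *\<^sub>R u))" .
qed

text \<open>Each coordinate functional of the target belongs to an \<open>M_pair\<close>; its
  pullback vanishes on the left summand, whose image therefore has zero right component.\<close>

lemma isometry_of_max_sum_c0_restricts:
  fixes U :: "'x::banach \<oplus>\<^sub>\<infinity> 'i c0 \<Rightarrow> 'w::banach \<oplus>\<^sub>\<infinity> 'j c0"
  assumes strict: "\<And>x y::'x. x \<noteq> 0 \<Longrightarrow> norm (x + y) \<le> norm x \<Longrightarrow> norm (x - y) \<le> norm x \<Longrightarrow> y = 0"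
    and kernel: "\<And>f :: 'x \<Rightarrow> real. linear f \<Longrightarrow> \<exists>x. x \<noteq> 0 \<and> f x = 0"
    and U: "linear U" "surj U" "\<And>v. norm (U v) = norm v"
  obtains V :: "'x \<Rightarrow> 'w" where "linear V" "\<And>x. norm (V x) = norm x"
proof
  let ?V = "\<lambda>x. left (U (of_pair (x, 0)))"
  have "right (U (of_pair (x, 0))) = 0" for x
  proof -
    have "coord (right (U (of_pair (x, 0)))) n = 0" for n
    proof -
      obtain u where "of_pair (0, unit_system n) = U u"
        by (rule surjE[OF U(2), of "of_pair (0, unit_system n)"], rule that)
      then have "M_pair u (\<lambda>v. coord (right (U v)) n)"
        using M_pair_unit_system[of n, where 'w='w] by (intro M_pair_pullback[OF U(1,3)]) simp
      then show ?thesis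
        by (rule M_pair_vanishes_on_strictly_convex[rotated 2]) (fact strict kernel)+
    qed
    then have "coord (right (U (of_pair (x, 0)))) = coord 0"
      by (intro ext) (simp add: zero_c0.rep_eq)
    then show ?thesis
      by (simp only: coord_inject)
  qed
  then show "norm (?V x) = norm x" for x
    using U(3)[of "of_pair (x, 0)"] by (simp add: norm_max_sum)
  show "linear ?V"
    using linear_compose[OF linear_compose[OF linear_of_pair_left U(1)]
        bounded_linear.linear[OF bounded_linear_left]]
    by (simp add: o_def)
qed


section \<open>Linear charts of planes\<close>

lemma plane_chart:
  assumes "dim (UNIV :: 'x::real_vector set) = 2"
  obtains P :: "complex \<Rightarrow> 'x::real_vector" where "linear P" "bij P"
proof -
  obtain B :: "'x set" where B: "independent B" "span B = UNIV" "card B = 2"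
    using basis_exists[of "UNIV :: 'x set"] assms by (metis top.extremum_uniqueI)
  then obtain a b where ab: "B = {a, b}" "a \<noteq> b"
    by (auto simp: card_2_iff)
  define P where "P z = Re z *\<^sub>R a + Im z *\<^sub>R b" for z
  have lin: "linear P"
    unfolding P_def by (intro linearI) (simp_all add: algebra_simps)
  have "surj P"
  proof -
    have "x \<in> range P" for x
    proof -
      have "x \<in> span {a, b}"
        using B ab by simp
      then obtain s t where "x - s *\<^sub>R a = t *\<^sub>R b"
        by (auto simp: span_breakdown_eq span_singleton)
      then have "x = P (Complex s t)"
        by (simp add: P_def algebra_simps)
      then show ?thesis by blast
    qed
    then show ?thesis by blast
  qed
  moreover have "inj P"
  proof (subst linear_injective_0[OF lin], intro allI impI)
    fix z assume z: "P z = 0"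
    have "b \<noteq> 0" "a \<notin> span {b}"
      using B(1) ab by (auto simp: independent_insert dependent_zero)
    have "Re z = 0"
    proof (rule ccontr)
      assume nz: "Re z \<noteq> 0"
      have "Re z *\<^sub>R a = - Im z *\<^sub>R b"
        using z by (simp add: P_def eq_neg_iff_add_eq_0)
      then have "(1 / Re z) *\<^sub>R Re z *\<^sub>R a = (1 / Re z) *\<^sub>R (- Im z) *\<^sub>R b"
        by simp
      then have "a = (- Im z / Re z) *\<^sub>R b"
        using nz by simp
      then have "a \<in> span {b}"
        unfolding span_singleton by blast
      then show False
        using \<open>a \<notin> span {b}\<close> by blast
    qed
    then show "z = 0"
      using z \<open>b \<noteq> 0\<close> by (simp add: P_def complex_eq_iff)
  qed
  ultimately show ?thesis
    using that lin by (simp add: bij_def)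
qed

text \<open>Norming functionals on the space and support vectors in the chart correspond through
  composition with \<open>P\<close> and its inverse, so uniqueness carries over.\<close>

lemma smooth_chart_support:
  fixes P :: "complex \<Rightarrow> 'x::banach"
  assumes smooth: "smooth_space TYPE('x)" and lin: "linear P" and bij: "bij P" and "z \<noteq> 0"
  shows "\<exists>!G. (\<forall>w. G \<bullet> w \<le> norm (P w)) \<and> G \<bullet> z = norm (P z)"
proof -
  let ?supp = "{f :: 'x \<Rightarrow>\<^sub>L real. norm f \<le> 1 \<and> blinfun_apply f (P z) = norm (P z)}"
  have inv: "inv P (P w) = w" "P (inv P x) = x" for w x
    using bij by (simp_all add: bij_is_inj bij_is_surj surj_f_inv_f)
  have "P z \<noteq> 0"
    using bij \<open>z \<noteq> 0\<close> linear_injective_0[OF lin] by (auto simp: bij_def)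
  then obtain f where f: "?supp = {f}"
    using smooth unfolding smooth_space_def by (meson is_singletonE)
  have fP: "linear (\<lambda>w. blinfun_apply f (P w))"
    using linear_compose[OF lin bounded_linear.linear[OF blinfun.bounded_linear_right]] by (simp add: o_def)
  \<comment> \<open>The adjoint at \<open>1\<close> is the Riesz vector of the functional pulled
    back along \<open>P\<close>.\<close>
  define G where "G = adjoint (\<lambda>w. blinfun_apply f (P w)) 1"
  have G: "G \<bullet> w = blinfun_apply f (P w)" for w
    using adjoint_works[OF fP, of w 1] by (simp add: G_def inner_commute)
  have "blinfun_apply f x \<le> norm x" for x
  proof -
    have "norm f \<le> 1"
      using f by blast
    then have "norm f * norm x \<le> 1 * norm x"
      by (intro mult_right_mono) auto
    then show ?thesis
      using norm_blinfun[of f x] by simp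
  qed
  moreover have "G' = G" if G': "\<And>w. G' \<bullet> w \<le> norm (P w)" "G' \<bullet> z = norm (P z)" for G'
  proof -
    have add: "inv P (x + y) = inv P x + inv P y" and scale: "inv P (r *\<^sub>R x) = r *\<^sub>R inv P x" for x y r
      using inv(1)[of "inv P x + inv P y"] inv(1)[of "r *\<^sub>R inv P x"]
      by (simp_all add: inv(2) linear_add[OF lin] linear_cmul[OF lin])
    have abs_le: "\<bar>G' \<bullet> inv P x\<bar> \<le> norm x" for x
      using G'(1)[of "inv P x"] G'(1)[of "- inv P x"] by (simp add: inv linear_neg[OF lin])
    have bl: "bounded_linear (\<lambda>x. G' \<bullet> inv P x)"
      by (rule bounded_linear_intro[where K=1]) (simp_all add: add scale inner_add_right abs_le)
    have "Blinfun (\<lambda>x. G' \<bullet> inv P x) \<in> ?supp"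
      using abs_le by (auto intro!: norm_blinfun_bound simp: bounded_linear_Blinfun_apply[OF bl] inv G')
    then have "blinfun_apply f = (\<lambda>x. G' \<bullet> inv P x)"
      using bounded_linear_Blinfun_apply[OF bl] unfolding f by simp
    then have "G' \<bullet> w = G \<bullet> w" for w
      by (simp add: G inv)
    then show ?thesis
      by (metis vector_eq_rdot)
  qed
  moreover have "G \<bullet> z = norm (P z)"
    using f unfolding G by blast
  ultimately show ?thesis
    by (intro ex1I[of _ G]) (auto simp: G)
qed

lemma linear_functional_vanishes_on_plane:
  fixes P :: "complex \<Rightarrow> 'x::real_vector" and f :: "'x \<Rightarrow> real"
  assumes "linear P" "inj P" "linear f"
  shows "\<exists>x. x \<noteq> 0 \<and> f x = 0"
proof -
  have nonzero: "P z \<noteq> 0" if "z \<noteq> 0" for z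
    using assms(2) that unfolding linear_injective_0[OF assms(1)] by blast
  show ?thesis
  proof (cases "f (P 1) = 0")
    case True
    then show ?thesis
      using nonzero[of 1] by (intro exI[of _ "P 1"]) simp
  next
    case False
    \<comment> \<open>The coefficients make the two values of \<open>f\<close> cancel; the imaginary
      part \<open>f (P 1)\<close> keeps the vector nonzero.\<close>
    let ?z = "f (P 1) *\<^sub>R \<i> - f (P \<i>) *\<^sub>R 1"
    have "f (P ?z) = 0"
      by (simp add: linear_diff[OF assms(1)] linear_cmul[OF assms(1)]
          linear_diff[OF assms(3)] linear_cmul[OF assms(3)])
    moreover have "P ?z \<noteq> 0"
      using False by (intro nonzero) (simp add: complex_eq_iff)
    ultimately show ?thesis
      by (intro exI[of _ "P ?z"]) simp
  qed
qed

text \<open>Conjugation yields an injective linear endomorphism of the complex plane, which is onto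
  by dimension.\<close>

lemma isometry_into_plane_surj:
  fixes P :: "complex \<Rightarrow> 'x::real_normed_vector" and V :: "'x \<Rightarrow> real^2"
  assumes "linear P" "inj P" "linear V" "\<And>x. norm (V x) = norm x"
  shows "surj V"
proof -
  obtain g :: "complex \<Rightarrow> real^2" and h :: "real^2 \<Rightarrow> complex" where gh: "linear g" "linear h"
    "\<And>z. norm (g z) = norm z" "\<And>x. norm (h x) = norm x" "\<And>z. h (g z) = z" "\<And>x. g (h x) = x"
    by (rule complex_isometry_plane, rule that)
  have lin: "linear (\<lambda>z. h (V (P z)))"
    using linear_compose[OF linear_compose[OF assms(1,3)] gh(2)] by (simp add: o_def)
  have "inj (\<lambda>z. h (V (P z)))"
    unfolding linear_injective_0[OF lin]
  proof (intro allI impI)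
    fix z assume "h (V (P z)) = 0"
    then have "norm (V (P z)) = 0"
      by (simp only: gh(4)[symmetric] norm_zero)
    then have "P z = 0"
      by (simp only: assms(4) norm_eq_zero)
    then show "z = 0"
      using assms(2) unfolding linear_injective_0[OF assms(1)] by simp
  qed
  then have surj: "surj (\<lambda>z. h (V (P z)))"
    by (rule linear_injective_imp_surjective[OF lin _ refl])
  show ?thesis
    unfolding surj_def
  proof
    fix y
    obtain z where "h y = h (V (P z))"
      by (rule surjE[OF surj, of "h y"], rule that)
    then have "g (h y) = g (h (V (P z)))"
      by (rule arg_cong)
    then have "y = V (P z)"
      by (simp only: gh(6))
    then show "\<exists>x. y = V x"
      by (rule exI)
  qed
qed

theorem theorem4p3:
  assumes "radon_plane TYPE('x::banach)"
    and "smooth_space TYPE('x)"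
    and "\<not> isometrically_isomorphic TYPE('x) TYPE(real^2)"
  shows "TYPE('x \<oplus>\<^sub>\<infinity> 'i c0) =\<^sub>B\<^sub>J TYPE((real^2) \<oplus>\<^sub>\<infinity> 'i c0) \<and>
    \<not> isometrically_isomorphic TYPE('x \<oplus>\<^sub>\<infinity> 'i c0) TYPE((real^2) \<oplus>\<^sub>\<infinity> 'i c0)"
proof -
  obtain P :: "complex \<Rightarrow> 'x" where linP: "linear P" and bijP: "bij P"
    by (rule plane_chart[OF assms(1)[unfolded radon_plane_def, THEN conjunct1]], rule that)
  note injP = bij_is_inj[OF bijP] and surjP = bij_is_surj[OF bijP]
  have chart: "smooth_radon_chart P"
    using assms(1) smooth_chart_support[OF assms(2) linP bijP] linP injP
    by (intro smooth_radon_chart.intro) (simp_all add: radon_plane_def)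
  obtain F :: "'x \<Rightarrow> real^2" where F: "norm_preserving F" "homogeneous_map F" "bij F" "bicontinuous F"
    "\<And>x y. half_orthogonal (F x) (F y) \<longleftrightarrow> half_orthogonal x y"
    by (rule smooth_radon_chart.bj_map_to_plane[OF chart surjP], rule that)
  have "\<not> isometrically_isomorphic TYPE('x \<oplus>\<^sub>\<infinity> 'i c0) TYPE((real^2) \<oplus>\<^sub>\<infinity> 'i c0)"
  proof
    assume "isometrically_isomorphic TYPE('x \<oplus>\<^sub>\<infinity> 'i c0) TYPE((real^2) \<oplus>\<^sub>\<infinity> 'i c0)"
    then obtain U :: "'x \<oplus>\<^sub>\<infinity> 'i c0 \<Rightarrow> (real^2) \<oplus>\<^sub>\<infinity> 'i c0"
      where "linear U \<and> surj U \<and> (\<forall>v. norm (U v) = norm v)"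
      unfolding isometrically_isomorphic_def by (rule exE)
    note U = this[THEN conjunct1] this[THEN conjunct2, THEN conjunct1]
      this[THEN conjunct2, THEN conjunct2, THEN spec]
    obtain V :: "'x \<Rightarrow> real^2" where V: "linear V" "\<And>x. norm (V x) = norm x"
    proof (rule isometry_of_max_sum_c0_restricts[OF _ _ U])
      show "y = 0" if "x \<noteq> 0" "norm (x + y) \<le> norm x" "norm (x - y) \<le> norm x" for x y :: 'x
        by (rule smooth_radon_chart.norm_strictly_convex[OF chart surjP that])
      show "\<exists>x. x \<noteq> 0 \<and> f x = 0" if "linear f" for f :: "'x \<Rightarrow> real"
        by (rule linear_functional_vanishes_on_plane[OF linP injP that])
    qed (rule that)
    then have "isometrically_isomorphic TYPE('x) TYPE(real^2)"
      unfolding isometrically_isomorphic_def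
      by (intro exI[of _ V] conjI allI isometry_into_plane_surj[OF linP injP])
    then show False
      using assms(3) by contradiction
  qed
  then show ?thesis
    using bj_equivalent_max_sum_c0[OF F] by (rule conjI[rotated])
qed

end
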